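(* Let $\{x^k:k\in\mathbb N\}$ be generated by algorithm iRPMVR in the full-step regime $\gamma_k\equiv1$, with exact tangent steps $\hat\eta^k$ and surrogate errors $e^k$, and suppose the error-dissipation condition holds (with constants $c_e,\mu,\nu$ and random variables $\mathcal E_k$). Suppose there are $\kappa_1,\kappa_2\ge0$, $k_0\in\mathbb N$, $r>2$ with $$\Delta_k\le\min\bigl\{\bar\Delta,\max\{\kappa_1\|\eta^{k-1}\|^2,\kappa_2(k-k_0)^{-r}\}\bigr\},\qquad k\ge k_0+1.$$ Let $\rho_1,\rho_2>0$, $\chi_e>\rho_1$, and set $a:=\frac1{2\alpha}-\frac{\ell_f}2-\frac{\rho_2}2$, $c_\eta:=\frac1{4\alpha}+\ell_f^2\rho_1+2L_\Phi$, $C_{\rm sh}:=\frac{C_1^2}{\alpha}+2L_\Phi C_1^2+\frac{C_1^2}{2\rho_1}+2C_0\ell_R$, $d_\alpha:=a-c_\eta$. Assume $$0<\bar\alpha<\min\Bigl\{C_\alpha,\tfrac1{\ell_f+\rho_2},\tfrac1{2\ell_f+2\rho_2+4\ell_f^2\rho_1+8L_\Phi+8\nu/\rho_2+16\chi_e\nu}\Bigr\}$$ and that $\kappa_1$ satisfies $$0\le\kappa_1<\frac{d_\alpha/4-\nu/(2\rho_2)-\chi_e\nu}{(d_\alpha C_1^2)/2+C_{\rm sh}}.$$ Then $\{\Phi_0(x^k,\hat\eta^k):k\in\mathbb N\}$ converges almost surely to a finite random variable $\Phi_\infty$. Moreover, almost surely, $\hat\eta^k\to0$, $\eta^k\to0$,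 $e^k\to0$, $\mathcal E_k\to0$. Consequently, every accumulation point of $\{x^k\}$ is a critical point of the problem $\min_{x\in\mathcal M}\Phi(x)$ almost surely.
   Context: Setting. $\mathcal M\subseteq\mathbb R^d$ is a compact embedded Riemannian submanifold (induced Euclidean metric) of dimension $d-p$, with tangent spaces $T_x\mathcal M$, normal spaces $N_x\mathcal M=(T_x\mathcal M)^\perp$, tangent bundle $T\mathcal M=\{(x,\eta):x\in\mathcal M,\eta\in T_x\mathcal M\}\subset\mathbb R^d\times\mathbb R^d$; $P_S$ is Euclidean projection onto a closed convex set $S$. $\Phi=F+R$, $F=\frac1n\sum_{j=1}^nf_j$. Each $f_j:\mathbb R^d\to\mathbb R$ is $C^1$; there is an open neighborhood $U$ of $\mathcal M$ on which every $\nabla f_j$ is Lipschitz with common constant $\ell_f$; $\|\nabla f_j(x)\|\le M_f$ for all $x\in\mathcal M$ and all $j$ ($M_f>0$ independent of $n$); $R:\mathbb R^d\to\mathbb R$ is convex and $\ell_R$-Lipschitz. $\operatorname{grad}h(x)=P_{T_x\mathcal M}\nabla h(x)$. $\operatorname{Retr}:T\mathcal M\to\mathcal M$ is a retraction (smooth, $\operatorname{Retr}_x(0)=x$, $D\operatorname{Retr}_x(0)=\mathrm{Id}$). $\mathcal M$ is covered by finitely many open sets $V_\ell$ with $\overline{V_\ell}\subseteq U_\ell$, $U_\ell$ open carrying smooth local defining functions $\psi_\ell:U_\ell\to\mathbb R^p$ of $\mathcal M$ whose differential has full row rank on $U_\ell\cap\mathcal M$; for $x\in\mathcal M$ pick $\ell(x)$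 with $x\in V_{\ell(x)}$ and set $B_x:=D\psi_{\ell(x)}(x)$, so $\ker B_x=T_x\mathcal M$. $C_0>0$ is a constant with $\operatorname{dist}(v,T_x\mathcal M)\le C_0\|B_xv\|$ for all $x\in\mathcal M$, $v\in\mathbb R^d$. A point $x\in\mathcal M$ is critical if $0\in\nabla F(x)+\partial R(x)+N_x\mathcal M$. Algorithm iRPMVR. Choose $x^0\in\mathcal M$, stepsize $0<\alpha\le\bar\alpha$, $0<\gamma\le1$, $\bar\Delta\ge0$, $0\le\bar\chi<1$, $M_u:=c_fM_f$ with $c_f\ge1$. Parameters $\gamma_k\in[\gamma,1]$, $\Delta_k\in[0,\bar\Delta]$, $\chi_k\in[0,\bar\chi]$ are chosen before sampling the $k$-th batch using only available history. Initialize $u^0=\hat u^0=\bar m^0=\operatorname{grad}F(x^0)$. For $k=0,1,\dots$: (a) if $k\ne0$, sample a random batch $\mathcal B_k$ from $\{1,\dots,n\}$, form from it and the current estimator state an estimator $u^k\in T_{x^k}\mathcal M$ of $\operatorname{grad}F(x^k)$, and set $\hat u^k=P_{\overline B(0,M_u)}u^k$; (b) $m^k=\chi_k\bar m^k+(1-\chi_k)\hat u^k$; (c) with $F_k(\eta):=\langle m^k,\eta\rangle+\frac1{2\alpha}\|\eta\|^2+R(x^k+\eta)$ and $G_k(\lambda):=F_k^*(-B_{x^k}^\top\lambda)$ ($F_k^*$ the Fenchel conjugate) find $\lambda^k\in\mathbb R^p$ with $\|\nabla G_k(\lambda^k)\|\le\Delta_k$; (d) $w^k=\operatorname{prox}_{\alpha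 R}(x^k-\alpha(m^k+B_{x^k}^\top\lambda^k))-x^k$, $\eta^k=P_{T_{x^k}\mathcal M}w^k$; (e) $x^{k+1}=\operatorname{Retr}_{x^k}(\gamma_k\eta^k)$; (f) $\bar m^{k+1}=P_{T_{x^{k+1}}\mathcal M}m^k$. The exact tangent step is $\hat\eta^k:=\arg\min_{\eta\in T_{x^k}\mathcal M}F_k(\eta)$ and $e^k:=m^k-\operatorname{grad}F(x^k)$. $\mathcal F_k$ is the natural filtration of the history before $\mathcal B_k$ is sampled (so $x^k,\bar m^k,\gamma_k,\Delta_k,\chi_k$ are $\mathcal F_k$-measurable); $\mathbb E_k=\mathbb E[\cdot\mid\mathcal F_k]$. Error-dissipation condition: there are constants $c_e,\mu,\nu>0$ and nonnegative $\mathcal F_k$-measurable random variables $\mathcal E_k$, $\mathbb E[\mathcal E_0]<\infty$, with $\mathbb E_k[\|e^k\|^2]+\mu\mathcal E_k\le c_e(\mathcal E_k-\mathbb E_k[\mathcal E_{k+1}])+\nu\mathbb E_k[\|\eta^k\|^2]$ for every $k\ge0$. Constants. $\delta,C_R,C_Q,L_R,L_\Phi,L_F>0$ are fixed such that for all $x\in\mathcal M$, $\eta\in T_x\mathcal M$, $\|\eta\|\le\delta$: $\|\operatorname{Retr}_x(\eta)-x\|\le C_R\|\eta\|$, $\|\operatorname{Retr}_x(\eta)-x-\eta\|\le C_Q\|\eta\|^2$, $|R(\operatorname{Retr}_x(\eta))-R(x+\eta)|\le L_R\|\eta\|^2$, $|\Phi(\operatorname{Retr}_x(\eta))-\Phi(x+\eta)|\le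 L_\Phi\|\eta\|^2$, $F(\operatorname{Retr}_x(\eta))-F(x)-\langle\operatorname{grad}F(x),\eta\rangle\le\frac{L_F}2\|\eta\|^2$. $\delta_T,L_T>0$ are fixed such that, for all $j$ (and likewise for $F$ in place of $f_j$), $\|\operatorname{grad}f_j(\operatorname{Retr}_x(\eta))-P_{T_{\operatorname{Retr}_x(\eta)}\mathcal M}\operatorname{grad}f_j(x)\|\le L_T\|\eta\|$ for $x\in\mathcal M$, $\eta\in T_x\mathcal M$ with $\|\eta\|\le\delta_T$, and $\|\operatorname{grad}f_j(y^i)-P_{T_{y^i}\mathcal M}\operatorname{grad}f_j(y^0)\|\le L_T\sum_{k=0}^{i-1}\|\zeta^k\|$ whenever $y^{k+1}=\operatorname{Retr}_{y^k}(\zeta^k)$ with $y^k\in\mathcal M$, $\zeta^k\in T_{y^k}\mathcal M$, $\|\zeta^k\|\le\delta_T$ for $k=0,\dots,i-1$. $C_1>0$ is a constant, independent of $k$ and $n$, with $\|\eta^k-\hat\eta^k\|\le C_1\sqrt{\Delta_k}$ for all $k\ge0$ (such a constant exists in this setting), and $$C_\alpha:=\left(\frac{\sqrt{\ell_RC_0\bar\Delta+(M_u+\ell_R)\min\{\delta,\delta_T\}}-\sqrt{\ell_RC_0\bar\Delta}}{M_u+\ell_R}\right)^2.$$ Shifted objective: $\Phi_0(x,\eta):=\Phi(x+\eta)+\iota_{T\mathcal M}(x,\eta)$ on $\mathbb R^d\times\mathbb R^d$ ($\iota$ the $0/+\infty$ indicator).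
   Formalization: Added assumption: δ is small enough that x+η lies in U (where the ∇f_j are ℓ_f-Lipschitz) for all x∈M and η∈T_xM with ‖η‖≤δ; without it the claim fails, e.g. on the unit circle with a thin annulus U and a retraction that twists outside U. *)

theory Defs
  imports "HOL-Probability.Probability"
begin

definition gradient :: "('a::real_inner \<Rightarrow> real) \<Rightarrow> 'a \<Rightarrow> 'a" where
  "gradient f x = (THE D. GDERIV f x :> D)"

text \<open>
  \<open>C\<^sup>k\<close> maps on an open subset of a finite-dimensional space: \<open>f\<close> is \<open>C\<^bsup>k+1\<^esup>\<close> iff it is
  differentiable and its derivative in every fixed direction is \<open>C\<^sup>k\<close>.
\<close>

primrec Ck_on ::
  "nat \<Rightarrow> 'a::euclidean_space set \<Rightarrow> ('a \<Rightarrow> 'b::euclidean_space) \<Rightarrow> bool" where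
  "Ck_on 0 S f \<longleftrightarrow> continuous_on S f"
| "Ck_on (Suc k) S f \<longleftrightarrow>
     (\<forall>x\<in>S. f differentiable (at x)) \<and> (\<forall>v. Ck_on k S (\<lambda>x. frechet_derivative f (at x) v))"

definition smooth_on :: "'a::euclidean_space set \<Rightarrow> ('a \<Rightarrow> 'b::euclidean_space) \<Rightarrow> bool" where
  "smooth_on S f \<longleftrightarrow> (\<forall>k. Ck_on k S f)"

text \<open>
  Smoothness of a map defined on an arbitrary subset \<open>A\<close> (used for an embedded submanifold such as
  the tangent bundle): near every point of \<open>A\<close> the map has a smooth extension to an open set of the
  ambient space.
\<close>

definition smooth_map_on :: "'a::euclidean_space set \<Rightarrow> ('a \<Rightarrow> 'b::euclidean_space) \<Rightarrow> bool" where
  "smooth_map_on A f \<longleftrightarrow>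
     (\<forall>a\<in>A. \<exists>W g. open W \<and> a \<in> W \<and> smooth_on W g \<and> (\<forall>y\<in>A \<inter> W. g y = f y))"

text \<open>
  A set \<open>M\<close> covered by the domains of local defining functions with values in \<open>'b\<close> is an embedded
  submanifold of dimension \<open>DIM('a) - DIM('b)\<close>.
\<close>

definition local_defining_function ::
  "'a::euclidean_space set \<Rightarrow> 'a set \<Rightarrow> ('a \<Rightarrow> 'b::euclidean_space) \<Rightarrow> bool" where
  "local_defining_function M U \<psi> \<longleftrightarrow>
     open U \<and> smooth_on U \<psi> \<and> M \<inter> U = {x \<in> U. \<psi> x = 0} \<and>
     (\<forall>x\<in>U \<inter> M. surj (frechet_derivative \<psi> (at x)))"

text \<open>Tangent vectors are the initial velocities of continuously differentiable curves in \<open>M\<close>.\<close>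

definition tangent_space :: "'a::euclidean_space set \<Rightarrow> 'a \<Rightarrow> 'a set" where
  "tangent_space M x =
     {v. \<exists>c c' \<epsilon>. \<epsilon> > 0 \<and> c 0 = x \<and> c' 0 = v \<and>
           (\<forall>t\<in>{-\<epsilon><..<\<epsilon>}. c t \<in> M \<and> (c has_vector_derivative c' t) (at t)) \<and>
           continuous_on {-\<epsilon><..<\<epsilon>::real} c'}"

definition normal_space :: "'a::euclidean_space set \<Rightarrow> 'a \<Rightarrow> 'a set" where
  "normal_space M x = (tangent_space M x)\<^sup>\<bottom>"

definition tangent_bundle :: "'a::euclidean_space set \<Rightarrow> ('a \<times> 'a) set" where
  "tangent_bundle M = {(x, \<eta>). x \<in> M \<and> \<eta> \<in> tangent_space M x}"

definition riem_grad :: "'a::euclidean_space set \<Rightarrow> ('a \<Rightarrow> real) \<Rightarrow> 'a \<Rightarrow> 'a" where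
  "riem_grad M h x = closest_point (tangent_space M x) (gradient h x)"

text \<open>
  The constant \<open>retraction\<close> of the library is the topological notion; the following is a retraction
  in the sense of Riemannian optimization.
\<close>

definition smooth_retraction :: "'a::euclidean_space set \<Rightarrow> ('a \<Rightarrow> 'a \<Rightarrow> 'a) \<Rightarrow> bool" where
  "smooth_retraction M Retr \<longleftrightarrow>
     (\<forall>(x, \<eta>)\<in>tangent_bundle M. Retr x \<eta> \<in> M) \<and>
     smooth_map_on (tangent_bundle M) (\<lambda>(x, \<eta>). Retr x \<eta>) \<and>
     (\<forall>x\<in>M. Retr x 0 = x \<and> (Retr x has_derivative (\<lambda>\<eta>. \<eta>)) (at 0 within tangent_space M x))"

definition subdifferential :: "('a::euclidean_space \<Rightarrow> real) \<Rightarrow> 'a \<Rightarrow> 'a set" where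
  "subdifferential R x = {s. \<forall>y. R y \<ge> R x + s \<bullet> (y - x)}"

definition critical_point ::
  "'a::euclidean_space set \<Rightarrow> ('a \<Rightarrow> real) \<Rightarrow> ('a \<Rightarrow> real) \<Rightarrow> 'a \<Rightarrow> bool" where
  "critical_point M F R x \<longleftrightarrow>
     x \<in> M \<and> 0 \<in> {gradient F x + s + v | s v. s \<in> subdifferential R x \<and> v \<in> normal_space M x}"

definition prox :: "('a::euclidean_space \<Rightarrow> real) \<Rightarrow> 'a \<Rightarrow> 'a" where
  "prox g z = arg_min_on (\<lambda>y. g y + (norm (y - z))\<^sup>2 / 2) UNIV"

text \<open>
  Real-valued conjugate. It is applied below to finite, strongly convex functions only, for which the
  supremum is finite.
\<close>

definition fenchel_conjugate :: "('a::euclidean_space \<Rightarrow> real) \<Rightarrow> 'a \<Rightarrow> real" where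
  "fenchel_conjugate g v = (SUP \<eta>. v \<bullet> \<eta> - g \<eta>)"

definition tangent_model ::
  "real \<Rightarrow> ('a::euclidean_space \<Rightarrow> real) \<Rightarrow> 'a \<Rightarrow> 'a \<Rightarrow> 'a \<Rightarrow> real" where
  "tangent_model \<alpha> R x m \<eta> = m \<bullet> \<eta> + (norm \<eta>)\<^sup>2 / (2 * \<alpha>) + R (x + \<eta>)"

definition dual_function ::
  "real \<Rightarrow> ('a::euclidean_space \<Rightarrow> real) \<Rightarrow> 'a \<Rightarrow> 'a \<Rightarrow> ('a \<Rightarrow> 'b::euclidean_space) \<Rightarrow> 'b \<Rightarrow> real"
where
  "dual_function \<alpha> R x m B z = fenchel_conjugate (tangent_model \<alpha> R x m) (- adjoint B z)"

definition shifted_objective ::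
  "'a::euclidean_space set \<Rightarrow> ('a \<Rightarrow> real) \<Rightarrow> 'a \<Rightarrow> 'a \<Rightarrow> ereal" where
  "shifted_objective M \<Phi> x \<eta> =
     ereal (\<Phi> (x + \<eta>)) + (if (x, \<eta>) \<in> tangent_bundle M then 0 else \<infinity>)"

definition preimages :: "'w measure \<Rightarrow> 'c measure \<Rightarrow> ('w \<Rightarrow> 'c) \<Rightarrow> 'w set set" where
  "preimages P N X = {X -` A \<inter> space P | A. A \<in> sets N}"

text \<open>
  The natural filtration: the information available immediately before the batch of iteration \<open>k\<close>
  is sampled. It consists of the iterates \<open>x\<close>, the transported estimators \<open>mbar\<close> and the states
  \<open>st\<close> of the estimator (with values in the measurable space \<open>N\<close>) up to index \<open>k\<close>, and of the
  batches, estimators, multipliers and steps of the earlier iterations. No batch is sampled in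
  iteration 0.
\<close>

definition history ::
  "'w measure \<Rightarrow> 's measure \<Rightarrow> (nat \<Rightarrow> 'w \<Rightarrow> 'a::euclidean_space) \<Rightarrow> (nat \<Rightarrow> 'w \<Rightarrow> 'a) \<Rightarrow>
   (nat \<Rightarrow> 'w \<Rightarrow> 's) \<Rightarrow> (nat \<Rightarrow> 'w \<Rightarrow> nat multiset) \<Rightarrow> (nat \<Rightarrow> 'w \<Rightarrow> 'a) \<Rightarrow>
   (nat \<Rightarrow> 'w \<Rightarrow> 'b::euclidean_space) \<Rightarrow> (nat \<Rightarrow> 'w \<Rightarrow> 'a) \<Rightarrow> nat \<Rightarrow> 'w measure" where
  "history P N x mbar st batch u lam \<eta> k = sigma (space P)
     ((\<Union>i\<in>{0..k}. preimages P borel (x i) \<union> preimages P borel (mbar i) \<union> preimages P N (st i)) \<union>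
      (\<Union>i\<in>{1..<k}. preimages P (count_space UNIV) (batch i)) \<union>
      (\<Union>i\<in>{0..<k}. preimages P borel (u i) \<union> preimages P borel (lam i) \<union> preimages P borel (\<eta> i)))"

text \<open>
  The inequality
  \<open>E\<^sub>k[\<bar>e\<^sub>k\<bar>\<^sup>2] + \<mu> Err\<^sub>k \<le> c\<^sub>e (Err\<^sub>k - E\<^sub>k[Err\<^sub>k\<^sub>+\<^sub>1]) + \<nu> E\<^sub>k[\<bar>\<eta>\<^sub>k\<bar>\<^sup>2]\<close>
  is stated in \<open>[0,\<infinity>]\<close>, with the only negative term moved to the left, since \<open>Err\<^sub>k\<^sub>+\<^sub>1\<close> is not known
  to be integrable beforehand (\<open>real_cond_exp\<close> would give a meaningless value if it is not).
\<close>

definition error_dissipation ::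
  "'w measure \<Rightarrow> (nat \<Rightarrow> 'w measure) \<Rightarrow> (nat \<Rightarrow> 'w \<Rightarrow> 'a::euclidean_space) \<Rightarrow> (nat \<Rightarrow> 'w \<Rightarrow> 'a) \<Rightarrow>
   real \<Rightarrow> real \<Rightarrow> real \<Rightarrow> (nat \<Rightarrow> 'w \<Rightarrow> real) \<Rightarrow> bool" where
  "error_dissipation P \<F> e \<eta> c\<^sub>e \<mu> \<nu> Err \<longleftrightarrow>
     c\<^sub>e > 0 \<and> \<mu> > 0 \<and> \<nu> > 0 \<and>
     (\<forall>k. Err k \<in> borel_measurable (\<F> k) \<and> (\<forall>\<omega>\<in>space P. Err k \<omega> \<ge> 0)) \<and>
     integrable P (Err 0) \<and>
     (\<forall>k. AE \<omega> in P.
        nn_cond_exp P (\<F> k) (\<lambda>\<omega>. ennreal ((norm (e k \<omega>))\<^sup>2)) \<omega> + ennreal (\<mu> * Err k \<omega>)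
          + ennreal c\<^sub>e * nn_cond_exp P (\<F> k) (\<lambda>\<omega>. ennreal (Err (Suc k) \<omega>)) \<omega>
        \<le> ennreal (c\<^sub>e * Err k \<omega>)
          + ennreal \<nu> * nn_cond_exp P (\<F> k) (\<lambda>\<omega>. ennreal ((norm (\<eta> k \<omega>))\<^sup>2)) \<omega>)"

end

theory Submission
  imports Defs
begin

text \<open>
  Testing the variational inequality of the inexact proximal step at \<open>\<eta> = 0\<close> gives
  \<open>R (x\<^sub>k + \<eta>\<^sub>k) + m\<^sub>k \<bullet> \<eta>\<^sub>k + \<bar>\<eta>\<^sub>k\<bar>\<^sup>2 / \<alpha> \<le> R x\<^sub>k + 2 l\<^sub>R C\<^sub>0 \<Delta>\<^sub>k\<close>, and hence a descent inequality
  for \<open>\<Phi> (x\<^sub>k)\<close> itself, with perturbation \<open>\<bar>e\<^sub>k\<bar>\<^sup>2 / (2 \<rho>\<^sub>2) + 2 l\<^sub>R C\<^sub>0 \<Delta>\<^sub>k\<close>. Adding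
  \<open>1 / (2 \<rho>\<^sub>2) + chi\<^sub>e\<close> times the dissipation inequality and taking plain expectations makes
  \<open>E \<bar>\<eta>\<^sub>k\<bar>\<^sup>2\<close>, \<open>E \<bar>e\<^sub>k\<bar>\<^sup>2\<close> and \<open>E Err\<^sub>k\<close> summable. So these quantities are almost surely summable
  along the trajectory, the perturbations of the descent inequality are too, and \<open>\<Phi> (x\<^sub>k)\<close>
  converges pathwise: no supermartingale theorem is needed. Criticality of accumulation points
  follows by passing to the limit in the minimality of the exact tangent steps.
\<close>

subsection \<open>Gradients and proximal steps\<close>

text \<open>Taking expectations requires integrable squares and a measurable \<open>e k\<close>.
  Integrability comes from \<open>\<alpha> < C\<^sub>\<alpha>\<close>: it keeps every step shorter
  than \<open>min \<delta> \<delta>\<^sub>T\<close> on the whole probability space, which also puts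
  each step within range of the retraction estimates. Measurability of \<open>e k\<close> rests on
  continuity of the Riemannian gradient, hence of the projection onto a moving tangent space. Since
  \<open>tangent_space\<close> is made of velocities of curves, even its linearity has to be
  derived: the inequality with \<open>C\<^sub>0\<close> puts each kernel vector of
  \<open>B y\<close> at distance zero from it, and the retraction shows that it is closed.

  The gain \<open>1 / \<alpha>\<close>, twice what comparing values of the tangent model would give,
  comes from using a subgradient at the proximal point. It makes the descent coefficient dominate
  \<open>d\<^sub>\<alpha>\<close>, so the bounds assumed on the step size and on
  \<open>\<kappa>\<^sub>1\<close> leave a positive margin. As \<open>\<Delta> k\<close> is
  controlled by the previous step, the Lyapunov function carries a delayed term.\<close>

lemma gradient_eq:
  fixes f :: "'a::real_inner \<Rightarrow> real"
  assumes "GDERIV f x :> D"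
  shows "gradient f x = D"
proof -
  have "D' = D" if "GDERIV f x :> D'" for D'
  proof -
    have "(\<lambda>h. inner h D') = (\<lambda>h. inner h D)"
      using that assms unfolding gderiv_def by (rule has_derivative_unique)
    then show ?thesis by (metis vector_eq_ldot)
  qed
  with assms show ?thesis unfolding gradient_def by blast
qed

lemma GDERIV_gradient:
  fixes f :: "'a::euclidean_space \<Rightarrow> real"
  assumes "f differentiable (at x)"
  shows "GDERIV f x :> gradient f x"
proof -
  obtain f' where f': "(f has_derivative f') (at x)"
    using assms unfolding differentiable_def by blast
  have "linear f'" using f' by (rule has_derivative_linear)
  then have "f' = (\<lambda>h. inner h (adjoint f' 1))"
    using adjoint_works[of f' _ 1] by (auto simp: fun_eq_iff)
  then have "GDERIV f x :> adjoint f' 1"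
    using f' unfolding gderiv_def by simp
  then show ?thesis using gradient_eq by metis
qed

text \<open>Monotonicity replaces integration: up to a constant, \<phi> is \<open>f\<close> along
  the segment minus the claimed bound, and the Lipschitz estimate makes its derivative nonpositive.
  Only the segment has to lie in \<open>U\<close>, which may fail to be convex.\<close>

lemma smooth_descent:
  fixes f :: "'a::real_inner \<Rightarrow> real"
  assumes der: "\<And>t. t \<in> {0..1} \<Longrightarrow> GDERIV f (x + t *\<^sub>R v) :> g (x + t *\<^sub>R v)"
    and lip: "L-lipschitz_on U g"
    and seg: "\<And>t. t \<in> {0..1} \<Longrightarrow> x + t *\<^sub>R v \<in> U"
  shows "f (x + v) \<le> f x + g x \<bullet> v + L / 2 * (norm v)\<^sup>2"
proof -
  define \<phi> where "\<phi> t = f (x + t *\<^sub>R v) - t * (g x \<bullet> v) - L / 2 * t\<^sup>2 * (norm v)\<^sup>2" for t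
  have "\<phi> 1 \<le> \<phi> 0"
  proof (rule DERIV_nonpos_imp_nonincreasing[of 0 1 \<phi>])
    fix t :: real assume "0 \<le> t" "t \<le> 1"
    then have t: "t \<in> {0..1}" by simp
    have "((\<lambda>t. f (x + t *\<^sub>R v)) has_derivative (\<lambda>s. inner (s *\<^sub>R v) (g (x + t *\<^sub>R v)))) (at t)"
      by (rule has_derivative_compose[where f = "\<lambda>t. x + t *\<^sub>R v" and g = f,
            OF _ der[OF t, unfolded gderiv_def]])
        (auto intro!: derivative_eq_intros)
    then have "DERIV (\<lambda>t. f (x + t *\<^sub>R v)) t :> g (x + t *\<^sub>R v) \<bullet> v"
      unfolding has_field_derivative_def by (simp add: inner_commute mult_commute_abs)
    then have "DERIV \<phi> t :> g (x + t *\<^sub>R v) \<bullet> v - g x \<bullet> v - L * t * (norm v)\<^sup>2"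
      unfolding \<phi>_def by (auto intro!: derivative_eq_intros)
    moreover have "(g (x + t *\<^sub>R v) - g x) \<bullet> v \<le> L * t * (norm v)\<^sup>2"
    proof -
      have "(g (x + t *\<^sub>R v) - g x) \<bullet> v \<le> norm (g (x + t *\<^sub>R v) - g x) * norm v"
        by (rule norm_cauchy_schwarz)
      also have "\<dots> \<le> (L * norm (t *\<^sub>R v)) * norm v"
        using lipschitz_onD[OF lip seg[OF t] seg[of 0]]
        by (intro mult_right_mono) (auto simp: dist_norm)
      finally show ?thesis using t by (simp add: power2_eq_square mult.assoc)
    qed
    ultimately show "\<exists>y. DERIV \<phi> t :> y \<and> y \<le> 0"
      by (intro exI conjI) (auto simp: inner_diff_left)
  qed simp
  then show ?thesis by (simp add: \<phi>_def)
qed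

text \<open>A Lipschitz \<open>h\<close> decreases at most linearly, so the quadratic wins outside a
  large ball about \<open>z\<close>; on the compact intersection of that ball with \<open>S\<close>
  the minimum is attained.\<close>

lemma proximal_minimizer_exists:
  fixes h :: "'a::euclidean_space \<Rightarrow> real"
  assumes lip: "L-lipschitz_on UNIV h" and S: "closed S" "S \<noteq> {}" and c: "c > 0"
  shows "\<exists>p\<in>S. \<forall>y\<in>S. h p + c * (norm (p - z))\<^sup>2 \<le> h y + c * (norm (y - z))\<^sup>2"
proof -
  obtain s where s: "s \<in> S" using S by blast
  define q where "q y = h y + c * (norm (y - z))\<^sup>2" for y
  define d where "d = norm (s - z)"
  \<comment> \<open>This radius gives \<open>c * t - L \<ge> L + c * d\<close> for every
    \<open>t \<ge> r\<close>; multiplied by \<open>t \<ge> d\<close>, it says that \<open>s\<close>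
    is at least as good as any point at distance \<open>t\<close> from \<open>z\<close>.\<close>
  define r where "r = 2 * L / c + d"
  have L: "L \<ge> 0" using lip by (rule lipschitz_on_nonneg)
  have d: "d \<ge> 0" "d \<le> r" using L c by (auto simp: d_def r_def)
  have cont: "continuous_on (S \<inter> cball z r) q"
    unfolding q_def
    by (intro continuous_intros continuous_on_subset[OF lipschitz_on_continuous_on[OF lip]]) auto
  have comp: "compact (S \<inter> cball z r)" using S(1) by (intro closed_Int_compact compact_cball)
  have sin: "s \<in> S \<inter> cball z r" using s d by (auto simp: d_def dist_norm norm_minus_commute)
  then obtain p where p: "p \<in> S \<inter> cball z r" "\<And>y. y \<in> S \<inter> cball z r \<Longrightarrow> q p \<le> q y"
    using continuous_attains_inf[OF comp _ cont] by blast
  have "q p \<le> q y" if y: "y \<in> S" for y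
  proof (cases "y \<in> cball z r")
    case True then show ?thesis using p y by blast
  next
    case False
    define t where "t = norm (y - z)"
    have t: "t \<ge> r" using False by (auto simp: t_def dist_norm norm_minus_commute)
    have "h s - h y \<le> L * norm (s - y)"
      using lipschitz_onD[OF lip, of s y] by (auto simp: dist_norm)
    also have "norm (s - y) \<le> d + t"
      using norm_triangle_ineq4[of "s - z" "y - z"] by (simp add: d_def t_def)
    finally have 1: "h s - h y \<le> L * (d + t)" using L by (simp add: mult_left_mono)
    have "c * t - L \<ge> L + c * d"
    proof -
      have "c * r \<le> c * t" using t c by simp
      moreover have "c * r = 2 * L + c * d" using c by (simp add: r_def field_simps)
      ultimately show ?thesis by linarith
    qed
    moreover have "t \<ge> d" using t d by linarith
    ultimately have "d * (L + c * d) \<le> t * (c * t - L)"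
      using L d c by (intro mult_mono) auto
    then have "c * d\<^sup>2 + L * (d + t) \<le> c * t\<^sup>2"
      by (simp add: algebra_simps power2_eq_square)
    then have "q s \<le> q y" using 1 unfolding q_def d_def t_def by linarith
    then show ?thesis using p(2)[OF sin] by linarith
  qed
  then show ?thesis using p(1) unfolding q_def by blast
qed

text \<open>Compare \<open>p\<close> with \<open>p + t (y - p)\<close>, divide by \<open>t\<close>
  and let \<open>t\<close> tend to 0. For \<open>z = p\<close> the quadratic disappears, so a
  minimizer of the penalized function minimizes \<open>h\<close> itself; limiting criticality uses
  this case.\<close>

lemma proximal_minimizer_variational:
  fixes h :: "'a::real_inner \<Rightarrow> real"
  assumes h: "convex_on S h" and p: "p \<in> S" and y: "y \<in> S"
    and min: "\<And>y. y \<in> S \<Longrightarrow> h p + c * (norm (p - z))\<^sup>2 \<le> h y + c * (norm (y - z))\<^sup>2"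
  shows "h y \<ge> h p - 2 * c * ((p - z) \<bullet> (y - p))"
proof -
  define A where "A = h y - h p + 2 * c * ((p - z) \<bullet> (y - p))"
  define b where "b = c * (norm (y - p))\<^sup>2"
  have "A + t * b \<ge> 0" if t: "0 < t" "t \<le> 1" for t
  proof -
    have S: "convex S" using h by (rule convex_on_imp_convex)
    have eq: "(1 - t) *\<^sub>R p + t *\<^sub>R y = p + t *\<^sub>R (y - p)" by (simp add: algebra_simps)
    have "(1 - t) *\<^sub>R p + t *\<^sub>R y \<in> S" using S p y t by (simp add: convexD)
    then have "h p + c * (norm (p - z))\<^sup>2
        \<le> h (p + t *\<^sub>R (y - p)) + c * (norm (p + t *\<^sub>R (y - p) - z))\<^sup>2"
      using min unfolding eq by blast
    moreover have "h (p + t *\<^sub>R (y - p)) \<le> (1 - t) * h p + t * h y"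
      using convex_onD[OF h, of t p y] p y t unfolding eq by auto
    moreover have "(norm (p + t *\<^sub>R (y - p) - z))\<^sup>2
        = (norm (p - z))\<^sup>2 + 2 * t * ((p - z) \<bullet> (y - p)) + t\<^sup>2 * (norm (y - p))\<^sup>2"
      unfolding power2_norm_eq_inner
      by (simp add: inner_simps inner_commute power2_eq_square algebra_simps)
    ultimately have "0 \<le> t * (h y - h p) + c * (2 * t * ((p - z) \<bullet> (y - p)) + t\<^sup>2 * (norm (y - p))\<^sup>2)"
      by (simp add: ring_distribs)
    also have "\<dots> = t * (A + t * b)"
      unfolding A_def b_def by (simp add: ring_distribs power2_eq_square)
    finally have "0 \<le> t * (A + t * b)" .
    then show ?thesis using t by (simp add: zero_le_mult_iff)
  qed
  then have "eventually (\<lambda>t. A + t * b \<ge> 0) (at_right 0)"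
    by (intro eventually_at_rightI[of 0 1]) auto
  moreover have "((\<lambda>t. A + t * b) \<longlongrightarrow> A + 0 * b) (at_right 0)"
    by (intro tendsto_intros)
  ultimately have "A + 0 * b \<ge> 0"
    by (intro tendsto_lowerbound[of _ _ "at_right (0::real)"]) auto
  then show ?thesis by (simp add: A_def)
qed

lemma arg_min_on_minimizer:
  fixes f :: "'a \<Rightarrow> 'b::linorder"
  assumes "p \<in> S" "\<And>y. y \<in> S \<Longrightarrow> f p \<le> f y"
  shows "arg_min_on f S \<in> S" "\<And>y. y \<in> S \<Longrightarrow> f (arg_min_on f S) \<le> f y"
proof -
  have "arg_min_on f S \<in> S \<and> (\<forall>y\<in>S. f (arg_min_on f S) \<le> f y)"
    unfolding arg_min_on_def
    by (rule arg_minI[where x = p]) (use assms in \<open>auto simp: not_less\<close>)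
  then show "arg_min_on f S \<in> S" "\<And>y. y \<in> S \<Longrightarrow> f (arg_min_on f S) \<le> f y" by auto
qed

lemma lipschitz_on_mult_const:
  fixes R :: "'a::metric_space \<Rightarrow> real"
  assumes "L-lipschitz_on S R" "c \<ge> 0"
  shows "(c * L)-lipschitz_on S (\<lambda>y. c * R y)"
  using lipschitz_on_cmult_real_nonneg[OF assms(1), of c] assms by (simp add: mult.commute)

lemma prox_subgradient:
  fixes R :: "'a::euclidean_space \<Rightarrow> real"
  assumes R: "convex_on UNIV R" "L-lipschitz_on UNIV R" and \<alpha>: "\<alpha> > 0"
  shows "R y \<ge> R (prox (\<lambda>y. \<alpha> * R y) z) + ((z - prox (\<lambda>y. \<alpha> * R y) z) /\<^sub>R \<alpha>) \<bullet> (y - prox (\<lambda>y. \<alpha> * R y) z)"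
proof -
  define p where "p = prox (\<lambda>y. \<alpha> * R y) z"
  have "\<exists>p\<in>UNIV. \<forall>y\<in>UNIV. \<alpha> * R p + (1/2) * (norm (p - z))\<^sup>2 \<le> \<alpha> * R y + (1/2) * (norm (y - z))\<^sup>2"
    by (rule proximal_minimizer_exists[OF lipschitz_on_mult_const[OF R(2)]]) (use \<alpha> in auto)
  then obtain q where q: "\<And>y. \<alpha> * R q + (norm (q - z))\<^sup>2 / 2 \<le> \<alpha> * R y + (norm (y - z))\<^sup>2 / 2"
    by auto
  have min: "\<alpha> * R p + (1/2) * (norm (p - z))\<^sup>2 \<le> \<alpha> * R y + (1/2) * (norm (y - z))\<^sup>2" for y
    using arg_min_on_minimizer(2)[of q UNIV "\<lambda>y. \<alpha> * R y + (norm (y - z))\<^sup>2 / 2" y] q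
    unfolding p_def prox_def by simp
  have "convex_on UNIV (\<lambda>y. \<alpha> * R y)" using R(1) \<alpha> by (intro convex_on_cmul) auto
  from proximal_minimizer_variational[OF this _ _ min, of y]
  have "\<alpha> * R p - (p - z) \<bullet> (y - p) \<le> \<alpha> * R y" by simp
  also have "\<alpha> * R p - (p - z) \<bullet> (y - p) = \<alpha> * (R p + ((z - p) /\<^sub>R \<alpha>) \<bullet> (y - p))"
    using \<alpha> by (simp add: distrib_left inner_diff_left)
  finally have "\<alpha> * (R p + ((z - p) /\<^sub>R \<alpha>) \<bullet> (y - p)) \<le> \<alpha> * R y" .
  then show ?thesis using \<alpha> unfolding p_def by simp
qed

lemma subgradient_norm_le:
  fixes R :: "'a::real_inner \<Rightarrow> real"
  assumes lip: "L-lipschitz_on UNIV R" and s: "\<And>y. R y \<ge> R p + s \<bullet> (y - p)"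
  shows "norm s \<le> L"
proof -
  have "(norm s)\<^sup>2 \<le> R (p + s) - R p"
    using s[of "p + s"] by (simp add: power2_norm_eq_inner)
  also have "\<dots> \<le> L * norm s"
    using lipschitz_onD[OF lip, of "p + s" p] by (auto simp: dist_norm)
  finally show ?thesis using lipschitz_on_nonneg[OF lip]
    by (cases "s = 0") (auto simp: power2_eq_square)
qed

lemma has_derivative_quadratic_bound:
  fixes f :: "'a::real_normed_vector \<Rightarrow> real"
  assumes D: "bounded_linear D" and b: "\<And>y. \<bar>f y - f x - D (y - x)\<bar> \<le> K * (norm (y - x))\<^sup>2"
  shows "(f has_derivative D) (at x)"
proof (rule has_derivativeI)
  have "((\<lambda>y. \<bar>K\<bar> * norm (y - x)) \<longlongrightarrow> \<bar>K\<bar> * norm (x - x)) (at x)"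
    by (intro tendsto_intros)
  then have "((\<lambda>y. \<bar>K\<bar> * norm (y - x)) \<longlongrightarrow> 0) (at x)" by simp
  then show "((\<lambda>y. (f y - f x - D (y - x)) /\<^sub>R norm (y - x)) \<longlongrightarrow> 0) (at x)"
  proof (rule Lim_null_comparison[rotated])
    show "\<forall>\<^sub>F y in at x. norm ((f y - f x - D (y - x)) /\<^sub>R norm (y - x)) \<le> \<bar>K\<bar> * norm (y - x)"
    proof (rule eventually_mono[OF eventually_neq_at_within[of x]])
      fix y assume "y \<noteq> x"
      have "\<bar>f y - f x - D (y - x)\<bar> \<le> \<bar>K\<bar> * (norm (y - x))\<^sup>2"
        by (rule order_trans[OF b]) (intro mult_right_mono, auto)
      then show "norm ((f y - f x - D (y - x)) /\<^sub>R norm (y - x)) \<le> \<bar>K\<bar> * norm (y - x)"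
        using \<open>y \<noteq> x\<close> by (simp add: field_simps power2_eq_square)
    qed
  qed
qed (rule D)

text \<open>As a function of \<open>v'\<close>, the conjugate lies between the affine function
  \<open>v' \<bullet> w - g w\<close> and that function plus a quadratic in \<open>v' - v\<close>,
  so both have the same derivative at \<open>v\<close>. The upper bound combines the quadratic gap
  at the maximizer \<open>w\<close> with Young's inequality.\<close>

lemma GDERIV_fenchel_conjugate:
  fixes g :: "'a::euclidean_space \<Rightarrow> real"
  assumes c: "c > 0" and w: "\<And>\<eta>. v \<bullet> \<eta> - g \<eta> \<le> v \<bullet> w - g w - c * (norm (\<eta> - w))\<^sup>2"
  shows "GDERIV (fenchel_conjugate g) v :> w"
  unfolding gderiv_def
proof (rule has_derivative_quadratic_bound[where K = "1 / (4 * c)"])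
  show "bounded_linear (\<lambda>h. h \<bullet> w)" by (rule bounded_linear_inner_left)
  have ub: "v' \<bullet> \<eta> - g \<eta> \<le> v \<bullet> w - g w + (v' - v) \<bullet> w + 1 / (4 * c) * (norm (v' - v))\<^sup>2" for v' \<eta>
  proof -
    have "(v' - v) \<bullet> (\<eta> - w) \<le> norm (v' - v) * norm (\<eta> - w)" by (rule norm_cauchy_schwarz)
    also have "\<dots> \<le> c * (norm (\<eta> - w))\<^sup>2 + 1 / (4 * c) * (norm (v' - v))\<^sup>2"
    proof -
      have "0 \<le> c * (norm (\<eta> - w) - norm (v' - v) / (2 * c))\<^sup>2" using c by simp
      also have "\<dots> = c * (norm (\<eta> - w))\<^sup>2 + 1 / (4 * c) * (norm (v' - v))\<^sup>2
          - norm (v' - v) * norm (\<eta> - w)"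
        using c by (simp add: power2_eq_square field_simps)
      finally show ?thesis by simp
    qed
    finally show ?thesis using w[of \<eta>] by (simp add: inner_simps)
  qed
  \<comment> \<open>The real-valued \<open>SUP\<close> is meaningful only for a set that is bounded
    above.\<close>
  have bdd: "bdd_above (range (\<lambda>\<eta>. v' \<bullet> \<eta> - g \<eta>))" for v' using ub by (intro bdd_aboveI2)
  have le: "fenchel_conjugate g v' \<le> v \<bullet> w - g w + (v' - v) \<bullet> w + 1 / (4 * c) * (norm (v' - v))\<^sup>2" for v'
    unfolding fenchel_conjugate_def using ub by (intro cSUP_least) auto
  have ge: "fenchel_conjugate g v' \<ge> v' \<bullet> w - g w" for v'
    unfolding fenchel_conjugate_def by (intro cSUP_upper bdd) auto
  have "fenchel_conjugate g v = v \<bullet> w - g w" using le[of v] ge[of v] by simp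
  then show "\<bar>fenchel_conjugate g v' - fenchel_conjugate g v - (v' - v) \<bullet> w\<bar>
      \<le> 1 / (4 * c) * (norm (v' - v))\<^sup>2" for v'
    using le[of v'] ge[of v'] c by (simp add: inner_simps)
qed

text \<open>Separate the strict epigraph of \<open>R\<close> from the affine set \<open>S\<close>,
  which lies weakly below the graph of \<open>R\<close> over \<open>z + T\<close>. If the separating
  normal is \<open>(p, q)\<close> with \<open>q > 0\<close>, then \<open>- p / q\<close> is the
  subgradient sought.\<close>

lemma first_order_condition_on_subspace:
  fixes R :: "'a::euclidean_space \<Rightarrow> real"
  assumes R: "convex_on UNIV R" and T: "subspace T"
    and le: "\<And>v. v \<in> T \<Longrightarrow> R z \<le> R (z + v) + G \<bullet> v"
  shows "\<exists>s\<in>subdifferential R z. \<forall>v\<in>T. (G + s) \<bullet> v = 0"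
proof -
  define S where "S = (\<lambda>v. (z + v, R z - G \<bullet> v)) ` T"
  define E where "E = {(y, t). R y < t}"
  have "convex S"
  proof -
    have "S = (\<lambda>u. (z, R z) + u) ` (\<lambda>v. (v, - (G \<bullet> v))) ` T" by (auto simp: S_def image_image)
    moreover have "linear (\<lambda>v. (v, - (G \<bullet> v)))"
      by (rule linearI) (auto simp: inner_simps)
    ultimately show ?thesis
      using T by (simp add: convex_translation convex_linear_image subspace_imp_convex)
  qed
  moreover have "convex E"
  proof (rule convexI, clarsimp simp: E_def)
    fix y t y' t' u v
    assume a: "R y < t" "R y' < t'" "0 \<le> u" "0 \<le> v" "u + v = (1::real)"
    have "R (u *\<^sub>R y + v *\<^sub>R y') \<le> u * R y + v * R y'"
      using R a unfolding convex_on_def by blast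
    also have "\<dots> < u * t + v * t'"
    proof (cases "u = 0")
      case False
      then have "u * R y < u * t" "v * R y' \<le> v * t'" using a by (auto intro: mult_left_mono)
      then show ?thesis by linarith
    qed (use a in auto)
    finally show "R (u *\<^sub>R y + v *\<^sub>R y') < u * t + v * t'" .
  qed
  moreover have "S \<noteq> {}" using T subspace_0 by (auto simp: S_def)
  moreover have "(y, R y + 1) \<in> E" for y by (simp add: E_def)
  then have "E \<noteq> {}" by blast
  moreover have "S \<inter> E = {}" using le by (force simp: S_def E_def)
  ultimately obtain pq b where pq: "pq \<noteq> 0" "\<And>x. x \<in> S \<Longrightarrow> pq \<bullet> x \<le> b" "\<And>x. x \<in> E \<Longrightarrow> pq \<bullet> x \<ge> b"
    using separating_hyperplane_sets[of S E] by blast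
  obtain p q where [simp]: "pq = (p, q)" by (cases pq)
  have S: "p \<bullet> (z + v) + q * (R z - G \<bullet> v) \<le> b" if "v \<in> T" for v
    using pq(2)[of "(z + v, R z - G \<bullet> v)"] that by (auto simp: S_def)
  have E: "p \<bullet> y + q * t \<ge> b" if "R y < t" for y t
    using pq(3)[of "(y, t)"] that by (auto simp: E_def)
  have S0: "p \<bullet> z + q * R z \<le> b" using S[of 0] T subspace_0 by auto
  have "q \<ge> 0" using E[of z "R z + 1"] S0 by (simp add: algebra_simps)
  \<comment> \<open>The hyperplane cannot be vertical, because the epigraph has points over all of
    the space; the one over \<open>z - p\<close> forces \<open>p = 0\<close>.\<close>
  moreover have "q \<noteq> 0"
  proof
    assume q: "q = 0"
    have "p \<bullet> (z - p) \<ge> b" using E[of "z - p" "R (z - p) + 1"] q by simp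
    then have "p \<bullet> p \<le> 0" using S0 q by (simp add: inner_simps)
    then have "p = 0" by (metis inner_eq_zero_iff inner_ge_zero order_antisym)
    then show False using pq(1) q by (simp add: zero_prod_def)
  qed
  ultimately have q: "q > 0" by simp
  have E': "p \<bullet> y + q * R y \<ge> b" for y
  proof (rule field_le_epsilon)
    fix e :: real assume "e > 0"
    then show "b \<le> p \<bullet> y + q * R y + e"
      using E[of y "R y + e / q"] q by (simp add: algebra_simps)
  qed
  define s where "s = - (p /\<^sub>R q)"
  have "s \<in> subdifferential R z"
    unfolding subdifferential_def
  proof (clarify)
    fix y
    have "q * (R z + s \<bullet> (y - z)) = q * R z - p \<bullet> y + p \<bullet> z"
      using q by (simp add: s_def inner_diff_right distrib_left right_diff_distrib
          mult.assoc[symmetric])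
    also have "\<dots> \<le> q * R y" using S0 E'[of y] by linarith
    finally show "R z + s \<bullet> (y - z) \<le> R y" using q by simp
  qed
  moreover have "(G + s) \<bullet> v = 0" if v: "v \<in> T" for v
  proof -
    \<comment> \<open>Boundary case of the separation at \<open>z\<close>. Since \<open>T\<close>
      contains \<open>- v\<close> along with \<open>v\<close>, the inequality becomes an
      equality.\<close>
    have "p \<bullet> v - q * (G \<bullet> v) \<le> 0" if "v \<in> T" for v
      using S[OF that] E'[of z] by (simp add: algebra_simps inner_simps)
    from this[OF v] this[of "- v"] have "p \<bullet> v = q * (G \<bullet> v)"
      using T v subspace_neg by fastforce
    then show ?thesis using q by (simp add: s_def inner_simps)
  qed
  ultimately show ?thesis by blast
qed

subsection \<open>Tangent spaces\<close>

lemma closest_point_subspace_orthogonal: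
  fixes S :: "'a::euclidean_space set"
  assumes S: "subspace S" and v: "v \<in> S"
  shows "(a - closest_point S a) \<bullet> v = 0"
proof -
  have cl: "closed S" "convex S" "S \<noteq> {}"
    using S by (auto simp: closed_subspace subspace_imp_convex subspace_0 dest: subspace_0)
  define p where "p = closest_point S a"
  have p: "p \<in> S" unfolding p_def using cl by (intro closest_point_in_set)
  have "(a - p) \<bullet> ((p + v) - p) \<le> 0"
    unfolding p_def using cl S v p by (intro closest_point_dot) (auto simp: p_def subspace_add)
  moreover have "(a - p) \<bullet> ((p - v) - p) \<le> 0"
    unfolding p_def using cl S v p by (intro closest_point_dot) (auto simp: p_def subspace_diff)
  ultimately show ?thesis unfolding p_def by simp
qed

lemma closest_point_in_subspace:
  fixes S :: "'a::euclidean_space set"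
  shows "subspace S \<Longrightarrow> closest_point S a \<in> S"
  using closest_point_in_set[of S a] closed_subspace[of S] subspace_0[of S] by blast

lemma closest_point_subspace_inner:
  fixes S :: "'a::euclidean_space set"
  assumes "subspace S" "v \<in> S"
  shows "closest_point S a \<bullet> v = a \<bullet> v"
  using closest_point_subspace_orthogonal[OF assms, of a] by (simp add: inner_diff_left)

lemma closest_point_subspace_norm_le:
  fixes S :: "'a::euclidean_space set"
  assumes S: "subspace S"
  shows "norm (closest_point S a) \<le> norm a"
proof -
  define p where "p = closest_point S a"
  have "p \<bullet> p = a \<bullet> p"
    unfolding p_def by (intro closest_point_subspace_inner S closest_point_in_subspace)
  then have "(norm p)\<^sup>2 \<le> norm a * norm p"
    using norm_cauchy_schwarz[of a p] by (simp add: power2_norm_eq_inner)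
  then show ?thesis unfolding p_def[symmetric] by (cases "p = 0") (auto simp: power2_eq_square)
qed

lemma closest_point_subspace_unique:
  fixes S :: "'a::euclidean_space set"
  assumes S: "subspace S" and p: "p \<in> S" and orth: "\<And>v. v \<in> S \<Longrightarrow> (a - p) \<bullet> v = 0"
  shows "closest_point S a = p"
proof -
  define d where "d = closest_point S a - p"
  have d: "d \<in> S" unfolding d_def using S p by (intro subspace_diff closest_point_in_subspace)
  have "d \<bullet> d = 0"
    using orth[OF d] closest_point_subspace_orthogonal[OF S d, of a]
    unfolding d_def by (simp add: inner_simps)
  then show ?thesis by (simp add: d_def)
qed

lemma infdist_closest_point:
  fixes S :: "'a::euclidean_space set"
  assumes "closed S" "S \<noteq> {}"
  shows "infdist a S = dist a (closest_point S a)"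
  using setdist_closest_point[OF assms] by (simp add: infdist_eq_setdist)

section \<open>Smooth maps and velocities of curves\<close>

lemma smooth_on_differentiable:
  assumes "smooth_on S f" "x \<in> S"
  shows "f differentiable (at x)"
proof -
  have "Ck_on 1 S f" using assms(1) unfolding smooth_on_def by blast
  then show ?thesis using assms(2) by simp
qed

lemma smooth_on_continuous_derivative:
  assumes "smooth_on S f"
  shows "continuous_on S (\<lambda>x. frechet_derivative f (at x) v)"
proof -
  have "Ck_on 1 S f" using assms(1) unfolding smooth_on_def by blast
  then show ?thesis by simp
qed

lemma smooth_on_linear_derivative:
  assumes "smooth_on S f" "x \<in> S"
  shows "linear (frechet_derivative f (at x))"
  using frechet_derivative_works[THEN iffD1, OF smooth_on_differentiable[OF assms]]
  by (rule has_derivative_linear)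

lemma smooth_on_has_vector_derivative:
  assumes f: "smooth_on S f" and x: "c t \<in> S" and c: "(c has_vector_derivative v) (at t)"
  shows "((\<lambda>s. f (c s)) has_vector_derivative frechet_derivative f (at (c t)) v) (at t)"
proof -
  have lin: "linear (frechet_derivative f (at (c t)))"
    using smooth_on_linear_derivative[OF f x] .
  have "((\<lambda>s. f (c s)) has_derivative (\<lambda>s. frechet_derivative f (at (c t)) (s *\<^sub>R v))) (at t)"
    by (rule has_derivative_compose[where f = c and g = f])
      (use c frechet_derivative_works[THEN iffD1, OF smooth_on_differentiable[OF f x]] in
        \<open>auto simp: has_vector_derivative_def\<close>)
  then show ?thesis unfolding has_vector_derivative_def by (simp add: linear_scale[OF lin])
qed

text \<open>Joint continuity in base point and direction: \<open>Ck_on\<close> provides continuity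
  for each fixed direction only, so the direction is expanded in the basis.\<close>

lemma derivative_tendsto:
  assumes f: "smooth_on S f" and S: "open S" and x: "x \<in> S"
    and y: "(y \<longlongrightarrow> x) G" and v: "(v \<longlongrightarrow> u) G"
  shows "((\<lambda>i. frechet_derivative f (at (y i)) (v i)) \<longlongrightarrow> frechet_derivative f (at x) u) G"
proof -
  have ev: "eventually (\<lambda>i. y i \<in> S) G" using topological_tendstoD[OF y S x] .
  have lin: "frechet_derivative f (at z) w
      = (\<Sum>b\<in>Basis. (w \<bullet> b) *\<^sub>R frechet_derivative f (at z) b)" if "z \<in> S" for z w
  proof -
    interpret linear "frechet_derivative f (at z)" using smooth_on_linear_derivative[OF f that] .
    show ?thesis by (subst euclidean_representation[of w, symmetric]) (simp only: sum scale)
  qed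
  have "((\<lambda>i. \<Sum>b\<in>Basis. (v i \<bullet> b) *\<^sub>R frechet_derivative f (at (y i)) b)
      \<longlongrightarrow> (\<Sum>b\<in>Basis. (u \<bullet> b) *\<^sub>R frechet_derivative f (at x) b)) G"
  proof (intro tendsto_intros v)
    fix b :: 'a
    have "isCont (\<lambda>x. frechet_derivative f (at x) b) x"
      using smooth_on_continuous_derivative[OF f] S x continuous_on_eq_continuous_at by blast
    then show "((\<lambda>i. frechet_derivative f (at (y i)) b) \<longlongrightarrow> frechet_derivative f (at x) b) G"
      using y by (rule isCont_tendsto_compose)
  qed
  then show ?thesis unfolding lin[OF x, of u]
    by (rule Lim_transform_eventually) (rule eventually_mono[OF ev], simp add: lin)
qed

text \<open>Near time 0 a curve in \<open>M\<close> stays in \<open>U\<close>, where \<psi> vanishes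
  along it; the chain rule at time 0 gives the claim.\<close>

lemma tangent_space_subset_kernel:
  assumes l: "local_defining_function M U \<psi>" and y: "y \<in> U" and v: "v \<in> tangent_space M y"
  shows "frechet_derivative \<psi> (at y) v = 0"
proof -
  obtain c c' e where c: "e > 0" "c 0 = y" "c' 0 = v"
    "\<And>t. t \<in> {-e<..<e} \<Longrightarrow> c t \<in> M \<and> (c has_vector_derivative c' t) (at t)"
    using v unfolding tangent_space_def by blast
  have U: "open U" "smooth_on U \<psi>" "M \<inter> U = {x \<in> U. \<psi> x = 0}"
    using l unfolding local_defining_function_def by auto
  have c0: "(c has_vector_derivative v) (at 0)" using c(4)[of 0] c by auto
  have 1: "((\<lambda>s. \<psi> (c s)) has_vector_derivative frechet_derivative \<psi> (at y) v) (at 0)"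
    using smooth_on_has_vector_derivative[OF U(2) _ c0] y c(2) by simp
  have "(c \<longlongrightarrow> y) (at 0)"
    using has_vector_derivative_continuous[OF c0] c(2) by (simp add: isCont_def)
  then have "eventually (\<lambda>t. c t \<in> U) (at 0)" using U(1) y by (rule topological_tendstoD)
  moreover have "eventually (\<lambda>t. t \<in> {-e<..<e}) (at 0)"
    using c(1) by (intro eventually_at_in_open') auto
  ultimately have ev: "eventually (\<lambda>t. \<psi> (c t) = 0) (at 0)"
    by eventually_elim (use c(4) U(3) in blast)
  have y0: "\<psi> (c 0) = 0" using c(4)[of 0] c(1,2) U(3) y by auto
  have "((\<lambda>s. \<psi> (c s)) has_vector_derivative 0) (at 0)"
  proof -
    have "((\<lambda>s. 0) has_vector_derivative 0) (at (0::real))" by (rule has_vector_derivative_const)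
    then show ?thesis unfolding has_vector_derivative_def
      by (rule has_derivative_transform_eventually) (use ev y0 in \<open>auto elim: eventually_mono\<close>)
  qed
  with 1 show ?thesis by (rule vector_derivative_unique_at)
qed

lemma tangent_spaceI:
  assumes "e > 0" "c 0 = y" "c' 0 = v" "\<And>t. t \<in> {-e<..<e} \<Longrightarrow> c t \<in> M"
    "\<And>t. t \<in> {-e<..<e} \<Longrightarrow> (c has_vector_derivative c' t) (at t)"
    "continuous_on {-e<..<e::real} c'"
  shows "v \<in> tangent_space M y"
  using assms unfolding tangent_space_def by blast

text \<open>Reparametrize the curve by the factor \<open>s\<close>. Sums of velocities have no such
  direct construction; additivity follows later from the kernel description.\<close>

lemma tangent_space_scaleR:
  assumes v: "v \<in> tangent_space M y"
  shows "s *\<^sub>R v \<in> tangent_space M y"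
proof -
  obtain c c' e where c: "e > 0" "c 0 = y" "c' 0 = v"
    "\<And>t. t \<in> {-e<..<e} \<Longrightarrow> c t \<in> M \<and> (c has_vector_derivative c' t) (at t)"
    "continuous_on {-e<..<e} c'"
    using v unfolding tangent_space_def by blast
  define d where "d = e / (\<bar>s\<bar> + 1)"
  have d: "d > 0" using c(1) by (simp add: d_def)
  have in_e: "s * t \<in> {-e<..<e}" if "t \<in> {-d<..<d}" for t
  proof -
    have "\<bar>s * t\<bar> \<le> (\<bar>s\<bar> + 1) * \<bar>t\<bar>" by (simp add: abs_mult algebra_simps)
    also have "\<dots> < (\<bar>s\<bar> + 1) * d" using that by (intro mult_strict_left_mono) auto
    also have "\<dots> = e" unfolding d_def by (simp add: field_simps add_pos_nonneg)
    finally show ?thesis by (auto simp: abs_less_iff)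
  qed
  have "((\<lambda>t. c (s * t)) has_vector_derivative s *\<^sub>R c' (s * t)) (at t)" if "t \<in> {-d<..<d}" for t
  proof -
    have "((\<lambda>t. s * t) has_vector_derivative s) (at t)"
      by (auto intro!: derivative_eq_intros)
    from vector_diff_chain_at[OF this, of c "c' (s * t)"] c(4)[OF in_e[OF that]]
    show ?thesis by (simp add: o_def)
  qed
  moreover have "continuous_on {-d<..<d} (\<lambda>t. s *\<^sub>R c' (s * t))"
    by (intro continuous_intros continuous_on_compose2[OF c(5)]) (use in_e in auto)
  ultimately show ?thesis
    using d c in_e
    by (intro tangent_spaceI[where e = d and c = "\<lambda>t. c (s * t)" and c' = "\<lambda>t. s *\<^sub>R c' (s * t)"]) auto
qed

lemma zero_in_tangent_space:
  assumes "y \<in> M"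
  shows "0 \<in> tangent_space M y"
  using assms
  by (intro tangent_spaceI[where e = 1 and c = "\<lambda>_. y" and c' = "\<lambda>_. 0"]) auto

text \<open>
  A smooth extension of the retraction maps \<open>(y, t v)\<close> into \<open>M\<close> for every limit \<open>v\<close> of tangent
  vectors, so that \<open>v\<close> is the velocity of a curve in \<open>M\<close>. This replaces the implicit function
  theorem in the identification of the tangent space with a kernel.
\<close>

lemma closed_tangent_space:
  assumes M: "closed M" and R: "smooth_retraction M Retr" and y: "y \<in> M"
  shows "closed (tangent_space M y)"
proof -
  define T where "T = tangent_space M y"
  have tb: "(y, v) \<in> tangent_bundle M \<longleftrightarrow> v \<in> T" for v
    using y by (simp add: tangent_bundle_def T_def)
  have 0: "0 \<in> T" using y zero_in_tangent_space by (simp add: T_def)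
  have scale: "s *\<^sub>R v \<in> T" if "v \<in> T" for s v using that tangent_space_scaleR by (auto simp: T_def)
  have RM: "Retr y v \<in> M" if "v \<in> T" for v
    using R tb that unfolding smooth_retraction_def by fastforce
  have R0: "Retr y 0 = y" "(Retr y has_derivative (\<lambda>\<eta>. \<eta>)) (at 0 within T)"
    using R y unfolding smooth_retraction_def T_def by auto
  obtain W g where W: "open W" "(y, 0) \<in> W" "smooth_on W g"
    "\<And>z. z \<in> tangent_bundle M \<inter> W \<Longrightarrow> g z = (case z of (x, \<eta>) \<Rightarrow> Retr x \<eta>)"
    using R tb[of 0] 0 unfolding smooth_retraction_def smooth_map_on_def by meson
  have g: "g (y, v) = Retr y v" if "v \<in> T" "(y, v) \<in> W" for v
    using W(4)[of "(y, v)"] that tb by simp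
  have curve: "((\<lambda>s. g (y, s *\<^sub>R v)) has_vector_derivative
      frechet_derivative g (at (y, t *\<^sub>R v)) (0, v)) (at t)" if "(y, t *\<^sub>R v) \<in> W" for t v
  proof -
    have "((\<lambda>s. (y, s *\<^sub>R v)) has_vector_derivative (0, v)) (at t)"
      by (auto intro!: derivative_eq_intros simp: has_vector_derivative_def)
    from smooth_on_has_vector_derivative[OF W(3) _ this] that show ?thesis by simp
  qed
  have evW: "eventually (\<lambda>t. (y, t *\<^sub>R v) \<in> W) (nhds 0)" for v
  proof -
    have "((\<lambda>t. (y, t *\<^sub>R v)) \<longlongrightarrow> (y, 0 *\<^sub>R v)) (nhds 0)"
      by (intro tendsto_intros filterlim_ident)
    then show ?thesis using W(1,2) by (auto dest!: topological_tendstoD)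
  qed
  \<comment> \<open>The derivative of \<open>Retr y\<close> at 0 is known only within
    \<open>T\<close>, so \<open>D (0, v) = v\<close> is first proved for \<open>v \<in> T\<close>,
    along the line through \<open>v\<close>, which stays in \<open>T\<close> by scaling. Continuity
    of the linear map \<open>D\<close> then extends it to limits.\<close>
  define D where "D = frechet_derivative g (at (y, 0))"
  have D_T: "D (0, v) = v" if v: "v \<in> T" for v
  proof -
    have "((\<lambda>s. g (y, s *\<^sub>R v)) has_vector_derivative D (0, v)) (at 0)"
      using curve[of 0 v] W(2) by (simp add: D_def)
    moreover have "((\<lambda>s. g (y, s *\<^sub>R v)) has_vector_derivative v) (at 0)"
    proof -
      have "(Retr y has_derivative (\<lambda>\<eta>. \<eta>)) (at (0 *\<^sub>R v) within range (\<lambda>s. s *\<^sub>R v))"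
        using has_derivative_subset[OF R0(2), of "range (\<lambda>s. s *\<^sub>R v)"] v scale by auto
      then have "((\<lambda>s. Retr y (s *\<^sub>R v)) has_derivative (\<lambda>s. s *\<^sub>R v)) (at 0)"
        by (intro has_derivative_in_compose[where f = "\<lambda>s. s *\<^sub>R v" and g = "Retr y"])
          (auto intro!: derivative_eq_intros)
      then show ?thesis unfolding has_vector_derivative_def
      proof (rule has_derivative_transform_eventually)
        show "\<forall>\<^sub>F s in at 0. Retr y (s *\<^sub>R v) = g (y, s *\<^sub>R v)"
          using evW[of v] unfolding eventually_at_filter
          by eventually_elim (use g v scale in auto)
      qed (use g[of 0] 0 W(2) in auto)
    qed
    ultimately show ?thesis by (rule vector_derivative_unique_at)
  qed
  have "v \<in> T" if lim: "\<And>i. u i \<in> T" "u \<longlonglongrightarrow> v" for u v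
  proof -
    obtain N where N: "open N" "0 \<in> N" "\<And>t. t \<in> N \<Longrightarrow> (y, t *\<^sub>R v) \<in> W"
      using evW[of v] unfolding eventually_nhds by blast
    then obtain e where e: "e > 0" "\<And>t. t \<in> {-e<..<e} \<Longrightarrow> (y, t *\<^sub>R v) \<in> W"
      unfolding open_dist by (force simp: dist_real_def)
    have inM: "g (y, t *\<^sub>R v) \<in> M" if t: "t \<in> {-e<..<e}" for t
    proof -
      have c: "isCont g (y, t *\<^sub>R v)"
        using smooth_on_differentiable[OF W(3) e(2)[OF t]] differentiable_imp_continuous_within by blast
      have l: "(\<lambda>i. (y, t *\<^sub>R u i)) \<longlonglongrightarrow> (y, t *\<^sub>R v)" by (intro tendsto_intros lim)
      have "eventually (\<lambda>i. g (y, t *\<^sub>R u i) \<in> M) sequentially"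
        using topological_tendstoD[OF l W(1) e(2)[OF t]]
        by eventually_elim (use g scale lim RM in auto)
      then show ?thesis using isCont_tendsto_compose[OF c l] M
        by (intro Lim_in_closed_set[of M _ sequentially]) auto
    qed
    have "continuous_on {-e<..<e} (\<lambda>t. frechet_derivative g (at (y, t *\<^sub>R v)) (0, v))"
      by (rule continuous_on_compose2[OF smooth_on_continuous_derivative[OF W(3)]])
        (auto intro!: continuous_intros e(2))
    moreover have "D (0, v) = v"
    proof -
      have "linear D" unfolding D_def using smooth_on_linear_derivative[OF W(3,2)] .
      then have "isCont D (0, v)" by (simp add: linear_continuous_at linear_conv_bounded_linear)
      moreover have "(\<lambda>i. (0, u i)) \<longlonglongrightarrow> (0, v)" by (intro tendsto_intros lim)
      ultimately have "(\<lambda>i. D (0, u i)) \<longlonglongrightarrow> D (0, v)" by (rule isCont_tendsto_compose)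
      then have "u \<longlonglongrightarrow> D (0, v)" using D_T lim by simp
      then show ?thesis using lim(2) by (rule LIMSEQ_unique)
    qed
    moreover have "g (y, 0) = y" using g[of 0] 0 W(2) R0 by simp
    ultimately show ?thesis unfolding T_def
      using e curve inM
      by (intro tangent_spaceI[where e = e and c = "\<lambda>t. g (y, t *\<^sub>R v)" and
            c' = "\<lambda>t. frechet_derivative g (at (y, t *\<^sub>R v)) (0, v)"]) (auto simp: D_def)
  qed
  then show ?thesis unfolding T_def[symmetric] closed_sequential_limits by blast
qed

text \<open>Both kernels have the same dimension, so one inclusion is enough. With a right inverse
  \<open>g\<close> of \<open>B\<close>, the map \<open>A\<close> factors through \<open>B\<close> as
  \<open>A \<circ> g \<circ> B\<close>, and \<open>A \<circ> g\<close> is a surjective endomorphism,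
  hence injective.\<close>

lemma surjective_linear_kernel_eq:
  fixes A B :: "'a::euclidean_space \<Rightarrow> 'b::euclidean_space"
  assumes A: "linear A" "surj A" and B: "linear B" "surj B"
    and le: "\<And>v. B v = 0 \<Longrightarrow> A v = 0"
  shows "A v = 0 \<longleftrightarrow> B v = 0"
proof
  interpret A: linear A by fact
  interpret B: linear B by fact
  obtain g where g: "linear g" "B \<circ> g = id" using linear_surjective_right_inverse B by blast
  have A_eq: "A u = A (g (B u))" for u
  proof -
    have "B (u - g (B u)) = 0" using g(2) by (simp add: B.diff fun_eq_iff)
    then show ?thesis using le[of "u - g (B u)"] by (simp add: A.diff)
  qed
  have "surj (A \<circ> g)"
  proof
    show "UNIV \<subseteq> range (A \<circ> g)"
    proof
      fix z obtain u where "z = A u" using A(2) by (metis surjD)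
      then show "z \<in> range (A \<circ> g)" using A_eq[of u] by auto
    qed
  qed auto
  moreover have "linear (A \<circ> g)" using linear_compose[OF g(1) A(1)] .
  ultimately have "inj (A \<circ> g)" using linear_surjective_imp_injective by blast
  moreover assume "A v = 0"
  then have "(A \<circ> g) (B v) = (A \<circ> g) 0" using A_eq[of v] linear_0[OF g(1)] A.zero by simp
  ultimately show "B v = 0" by (rule injD)
qed (rule le)

section \<open>Tangent spaces as kernels, and continuity of the projections onto them\<close>

locale embedded_submanifold =
  fixes M :: "'a::euclidean_space set" and I :: "nat set" and V Uloc :: "nat \<Rightarrow> 'a set"
    and \<psi> :: "nat \<Rightarrow> 'a \<Rightarrow> 'b::euclidean_space" and ell :: "'a \<Rightarrow> nat" and B :: "'a \<Rightarrow> 'a \<Rightarrow> 'b"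
    and C\<^sub>0 :: real and Retr :: "'a \<Rightarrow> 'a \<Rightarrow> 'a"
  assumes M_compact: "compact M"
    and cover: "finite I" "M \<subseteq> (\<Union>i\<in>I. V i)"
      "\<And>i. i \<in> I \<Longrightarrow> open (V i) \<and> closure (V i) \<subseteq> Uloc i \<and> local_defining_function M (Uloc i) (\<psi> i)"
    and ell: "\<And>y. y \<in> M \<Longrightarrow> ell y \<in> I \<and> y \<in> V (ell y)"
    and B_eq: "\<And>y. y \<in> M \<Longrightarrow> B y = frechet_derivative (\<psi> (ell y)) (at y)"
    and C0: "C\<^sub>0 > 0" "\<And>y v. y \<in> M \<Longrightarrow> infdist v (tangent_space M y) \<le> C\<^sub>0 * norm (B y v)"
    and Retr: "smooth_retraction M Retr"
begin

lemma V_subset_Uloc: "i \<in> I \<Longrightarrow> V i \<subseteq> Uloc i"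
  using cover(3) closure_subset by blast

lemma chart:
  assumes "i \<in> I"
  shows "open (Uloc i)" "smooth_on (Uloc i) (\<psi> i)"
    "\<And>y. y \<in> Uloc i \<Longrightarrow> y \<in> M \<Longrightarrow> surj (frechet_derivative (\<psi> i) (at y))"
  using cover(3)[OF assms] unfolding local_defining_function_def by auto

lemma chart_derivative_linear:
  "i \<in> I \<Longrightarrow> y \<in> Uloc i \<Longrightarrow> linear (frechet_derivative (\<psi> i) (at y))"
  using chart(2) smooth_on_linear_derivative by blast

lemma linear_B: "y \<in> M \<Longrightarrow> linear (B y)"
  using B_eq ell chart_derivative_linear V_subset_Uloc by fastforce

text \<open>One inclusion differentiates along curves. For the other, the bound with
  \<open>C\<^sub>0\<close> puts a kernel vector at distance zero from the tangent space, which is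
  closed.\<close>

lemma tangent_space_eq_kernel:
  assumes y: "y \<in> M"
  shows "tangent_space M y = {v. B y v = 0}"
proof (intro equalityI subsetI; clarsimp)
  fix v assume "v \<in> tangent_space M y"
  then show "B y v = 0"
    using tangent_space_subset_kernel[of M "Uloc (ell y)" "\<psi> (ell y)" y v] cover(3) ell y
      V_subset_Uloc B_eq by fastforce
next
  fix v assume "B y v = 0"
  then have "infdist v (tangent_space M y) = 0"
    using C0(2)[OF y, of v] infdist_nonneg[of v "tangent_space M y"] by simp
  moreover have "closed (tangent_space M y)"
    using closed_tangent_space[OF compact_imp_closed[OF M_compact] Retr y] .
  ultimately show "v \<in> tangent_space M y"
    using in_closed_iff_infdist_zero zero_in_tangent_space[OF y] by fastforce
qed

lemma subspace_tangent_space: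
  assumes y: "y \<in> M"
  shows "subspace (tangent_space M y)"
proof -
  interpret linear "B y" using linear_B[OF y] .
  show ?thesis unfolding tangent_space_eq_kernel[OF y] by (rule subspaceI) (auto simp: add scale zero)
qed

text \<open>Frees the description from the selected index \<open>ell y\<close>: along a convergent
  sequence that index may jump, while a chart around the limit serves all late terms. Surjectivity
  of both derivatives makes one inclusion of kernels enough.\<close>

lemma tangent_space_eq_chart_kernel:
  assumes y: "y \<in> M" and i: "i \<in> I" "y \<in> Uloc i"
  shows "tangent_space M y = {v. frechet_derivative (\<psi> i) (at y) v = 0}"
proof -
  have "frechet_derivative (\<psi> i) (at y) v = 0 \<longleftrightarrow> B y v = 0" for v
  proof (rule surjective_linear_kernel_eq[where B = "B y"])
    show "surj (B y)" using B_eq[OF y] chart(3)[of "ell y" y] ell[OF y] V_subset_Uloc y by auto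
    show "frechet_derivative (\<psi> i) (at y) v = 0" if "B y v = 0" for v
      using that tangent_space_eq_kernel[OF y]
        tangent_space_subset_kernel[of M "Uloc i" "\<psi> i" y v] cover(3)[OF i(1)] i(2) by blast
  qed (use chart(3) chart_derivative_linear linear_B i y in auto)
  then show ?thesis unfolding tangent_space_eq_kernel[OF y] by blast
qed

lemma dist_closest_tangent_le:
  assumes y: "y \<in> M"
  shows "norm (v - closest_point (tangent_space M y) v) \<le> C\<^sub>0 * norm (B y v)"
  using C0(2)[OF y, of v]
    infdist_closest_point[of "tangent_space M y" v] subspace_tangent_space[OF y]
  by (metis closed_subspace dist_norm empty_iff subspace_0)

text \<open>
  Inner semicontinuity of the tangent spaces. The chart index \<open>ell (y i)\<close> may oscillate along the
  sequence, so the bound sums over all charts; charts whose closure misses the limit drop out.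
\<close>

lemma closest_tangent_tendsto:
  assumes y: "\<And>i. y i \<in> M" "y \<longlonglongrightarrow> z" and z: "z \<in> M" and v: "v \<in> tangent_space M z"
  shows "(\<lambda>i. closest_point (tangent_space M (y i)) v) \<longlonglongrightarrow> v"
proof -
  define q where "q l i = (if y i \<in> V l then norm (frechet_derivative (\<psi> l) (at (y i)) v) else 0)" for l i
  have "q l \<longlonglongrightarrow> 0" if l: "l \<in> I" for l
  proof (cases "z \<in> closure (V l)")
    case True
    then have zU: "z \<in> Uloc l" using cover(3)[OF l] by blast
    have "(\<lambda>i. frechet_derivative (\<psi> l) (at (y i)) v) \<longlonglongrightarrow> frechet_derivative (\<psi> l) (at z) v"
      using chart(1,2)[OF l] zU y(2) by (intro derivative_tendsto[of "Uloc l"]) auto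
    moreover have "frechet_derivative (\<psi> l) (at z) v = 0"
      using tangent_space_subset_kernel[of M "Uloc l" "\<psi> l" z v] cover(3)[OF l] zU v by blast
    ultimately have "(\<lambda>i. norm (frechet_derivative (\<psi> l) (at (y i)) v)) \<longlonglongrightarrow> 0"
      using tendsto_norm_zero by simp
    then show ?thesis
      by (rule Lim_null_comparison[rotated]) (auto simp: q_def)
  next
    case False
    then have "eventually (\<lambda>i. y i \<in> - closure (V l)) sequentially"
      by (intro topological_tendstoD[OF y(2)]) auto
    then have "eventually (\<lambda>i. q l i = 0) sequentially"
      by eventually_elim (use closure_subset[of "V l"] in \<open>auto simp: q_def\<close>)
    then show ?thesis by (rule tendsto_eventually)
  qed
  then have lim: "(\<lambda>i. C\<^sub>0 * (\<Sum>l\<in>I. q l i)) \<longlonglongrightarrow> C\<^sub>0 * (\<Sum>l\<in>I. 0)"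
    by (intro tendsto_intros)
  have "norm (closest_point (tangent_space M (y i)) v - v) \<le> C\<^sub>0 * (\<Sum>l\<in>I. q l i)" for i
  proof -
    have "norm (B (y i) v) = q (ell (y i)) i"
      using ell[OF y(1)] B_eq[OF y(1)] by (simp add: q_def)
    also have "\<dots> \<le> (\<Sum>l\<in>I. q l i)"
      using cover(1) ell[OF y(1)] by (intro member_le_sum) (auto simp: q_def)
    finally show ?thesis
      using dist_closest_tangent_le[OF y(1), of v i] C0(1)
      by (simp add: norm_minus_commute order_trans)
  qed
  then have "(\<lambda>i. closest_point (tangent_space M (y i)) v - v) \<longlonglongrightarrow> 0"
    by (intro Lim_null_comparison[OF _ lim[simplified]] always_eventually allI)
  then show ?thesis by (simp add: LIM_zero_iff)
qed

text \<open>A map into a compact ball with closed graph is continuous. A limit \<open>p\<close> of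
  projections is recognized as the projection at the limit point by tangency and orthogonality of
  the residual. The result is used for the measurability of the Riemannian gradient along the
  iterates.\<close>

lemma continuous_on_closest_tangent:
  assumes g: "continuous_on M g"
  shows "continuous_on M (\<lambda>y. closest_point (tangent_space M y) (g y))"
proof -
  define P where "P y = closest_point (tangent_space M y) (g y)" for y
  obtain K where K: "\<And>y. y \<in> M \<Longrightarrow> norm (g y) \<le> K"
    using compact_imp_bounded[OF compact_continuous_image[OF g M_compact]]
    unfolding bounded_iff by auto
  have "norm (P y) \<le> K" if "y \<in> M" for y
    using closest_point_subspace_norm_le[OF subspace_tangent_space[OF that], of "g y"] K[OF that]
    unfolding P_def by linarith
  then have im: "P \<in> M \<rightarrow> cball 0 K" by auto
  have "closed ((\<lambda>y. (y, P y)) ` M)"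
    unfolding closed_sequential_limits
  proof (intro allI impI; elim conjE)
    fix s l assume s: "\<forall>i. s i \<in> (\<lambda>y. (y, P y)) ` M" and l: "s \<longlonglongrightarrow> l"
    define y where "y i = fst (s i)" for i
    define z p where "z = fst l" and "p = snd l"
    have yM: "y i \<in> M" and sP: "snd (s i) = P (y i)" for i using s[rule_format, of i] by (auto simp: y_def)
    have yz: "y \<longlonglongrightarrow> z" unfolding y_def z_def by (rule tendsto_fst[OF l])
    have Pp: "(\<lambda>i. P (y i)) \<longlonglongrightarrow> p" using tendsto_snd[OF l] by (simp add: sP p_def)
    have zM: "z \<in> M"
      using compact_imp_closed[OF M_compact] yM yz closed_sequentially by blast
    have gz: "(\<lambda>i. g (y i)) \<longlonglongrightarrow> g z"
      using continuous_on_tendsto_compose[OF g yz zM] yM by simp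
    have "closest_point (tangent_space M z) (g z) = p"
    proof (rule closest_point_subspace_unique[OF subspace_tangent_space[OF zM]])
      define i where "i = ell z"
      have i: "i \<in> I" "z \<in> V i" "z \<in> Uloc i" using ell[OF zM] V_subset_Uloc by (auto simp: i_def)
      have "(\<lambda>j. frechet_derivative (\<psi> i) (at (y j)) (P (y j))) \<longlonglongrightarrow> frechet_derivative (\<psi> i) (at z) p"
        using chart(1,2)[OF i(1)] i yz Pp by (intro derivative_tendsto[of "Uloc i"]) auto
      moreover have "eventually (\<lambda>j. frechet_derivative (\<psi> i) (at (y j)) (P (y j)) = 0) sequentially"
        using topological_tendstoD[OF yz chart(1)[OF i(1)] i(3)]
      proof eventually_elim
        case (elim j)
        have "P (y j) \<in> tangent_space M (y j)"
          unfolding P_def by (intro closest_point_in_subspace subspace_tangent_space yM)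
        then show ?case using tangent_space_eq_chart_kernel[OF yM i(1) elim] by blast
      qed
      ultimately have "frechet_derivative (\<psi> i) (at z) p = 0"
        by (intro LIMSEQ_unique[OF _ tendsto_eventually])
      then show "p \<in> tangent_space M z" using tangent_space_eq_chart_kernel[OF zM i(1,3)] by blast
      fix v assume v: "v \<in> tangent_space M z"
      \<comment> \<open>A test vector \<open>v\<close> tangent at \<open>z\<close> need not be
        tangent at \<open>y j\<close>; its projections are, and they converge to
        \<open>v\<close>.\<close>
      have "(\<lambda>j. (g (y j) - P (y j)) \<bullet> closest_point (tangent_space M (y j)) v) \<longlonglongrightarrow> (g z - p) \<bullet> v"
        by (intro tendsto_inner tendsto_diff gz Pp closest_tangent_tendsto[OF yM yz zM v])
      moreover have "(g (y j) - P (y j)) \<bullet> closest_point (tangent_space M (y j)) v = 0" for j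
        unfolding P_def
        by (intro closest_point_subspace_orthogonal closest_point_in_subspace subspace_tangent_space yM)
      ultimately show "(g z - p) \<bullet> v = 0" by (simp add: LIMSEQ_const_iff)
    qed
    then have "l = (z, P z)" by (simp add: P_def z_def p_def)
    then show "l \<in> (\<lambda>y. (y, P y)) ` M" using zM by blast
  qed
  then have "closedin (top_of_set (M \<times> cball 0 K)) ((\<lambda>y. (y, P y)) ` M)"
    using im by (intro closed_subset) auto
  then have "continuous_on M P" using continuous_closed_graph_eq[OF compact_cball im] by simp
  then show ?thesis unfolding P_def .
qed

end

subsection \<open>Inexact tangent steps\<close>

text \<open>By optimality of the proximal point, \<open>w\<close> maximizes
  \<open>- q \<bullet> \<eta>\<close> minus the tangent model, with a quadratic gap; so it is the
  gradient of the conjugate at \<open>- q\<close>, and the chain rule contributes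
  \<open>- B\<close>. The stopping test of the algorithm therefore bounds
  \<open>norm (B w)\<close>.\<close>

lemma gradient_dual_function:
  fixes B :: "'a::euclidean_space \<Rightarrow> 'b::euclidean_space"
  assumes R: "convex_on UNIV R" "L-lipschitz_on UNIV R" and \<alpha>: "\<alpha> > 0" and B: "linear B"
    and w: "w = prox (\<lambda>y. \<alpha> * R y) (x - \<alpha> *\<^sub>R (m + adjoint B z)) - x"
  shows "gradient (dual_function \<alpha> R x m B) z = - B w"
proof (rule gradient_eq)
  define q where "q = adjoint B z"
  have sub: "R (x + \<eta>) \<ge> R (x + w) - (m + q + w /\<^sub>R \<alpha>) \<bullet> (\<eta> - w)" for \<eta>
    using prox_subgradient[OF R \<alpha>, of "x - \<alpha> *\<^sub>R (m + adjoint B z)" "x + \<eta>"] \<alpha>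
    by (simp add: w q_def algebra_simps inner_simps)
  have "- q \<bullet> \<eta> - tangent_model \<alpha> R x m \<eta>
      \<le> - q \<bullet> w - tangent_model \<alpha> R x m w - 1 / (2 * \<alpha>) * (norm (\<eta> - w))\<^sup>2" for \<eta>
  proof -
    have "(norm \<eta>)\<^sup>2 = (norm w)\<^sup>2 + 2 * (w \<bullet> (\<eta> - w)) + (norm (\<eta> - w))\<^sup>2"
      unfolding power2_norm_eq_inner by (simp add: inner_simps inner_commute)
    then have "(norm \<eta>)\<^sup>2 / (2 * \<alpha>) = (norm w)\<^sup>2 / (2 * \<alpha>) + (w /\<^sub>R \<alpha>) \<bullet> (\<eta> - w)
        + 1 / (2 * \<alpha>) * (norm (\<eta> - w))\<^sup>2"
      using \<alpha> by (simp add: field_simps)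
    then show ?thesis
      using sub[of \<eta>] unfolding tangent_model_def by (simp add: inner_simps)
  qed
  then have "GDERIV (fenchel_conjugate (tangent_model \<alpha> R x m)) (- q) :> w"
    using \<alpha> by (intro GDERIV_fenchel_conjugate[of "1 / (2 * \<alpha>)"]) auto
  then have fc: "(fenchel_conjugate (tangent_model \<alpha> R x m) has_derivative (\<lambda>h. h \<bullet> w))
      (at (- adjoint B z))"
    unfolding gderiv_def q_def .
  have "((\<lambda>z. - adjoint B z) has_derivative (\<lambda>h. - adjoint B h)) (at z)"
    by (intro has_derivative_minus linear_imp_has_derivative adjoint_linear B)
  from has_derivative_compose[OF this fc]
  have "(dual_function \<alpha> R x m B has_derivative (\<lambda>h. (- adjoint B h) \<bullet> w)) (at z)"
    unfolding dual_function_def by simp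
  then show "GDERIV (dual_function \<alpha> R x m B) z :> - B w"
    unfolding gderiv_def using adjoint_works[OF B, of w] by (simp add: inner_commute)
qed

text \<open>The multiplier term \<open>q\<close> is normal to \<open>T\<close> and drops out.
  Replacing \<open>w\<close> by its projection \<eta> costs \<open>L * D\<close> twice: in the value
  of \<open>R\<close> and in the pairing with the subgradient \<open>s\<close>.\<close>

lemma inexact_proximal_step:
  fixes R :: "'a::euclidean_space \<Rightarrow> real"
  assumes R: "convex_on UNIV R" "L-lipschitz_on UNIV R" and \<alpha>: "\<alpha> > 0"
    and T: "subspace T" and q: "\<And>v. v \<in> T \<Longrightarrow> q \<bullet> v = 0"
    and w: "w = prox (\<lambda>y. \<alpha> * R y) (x - \<alpha> *\<^sub>R (m + q)) - x"
    and \<eta>: "\<eta> = closest_point T w" and D: "norm (w - \<eta>) \<le> D"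
  shows "R (x + \<eta>) + m \<bullet> \<eta> + (norm \<eta>)\<^sup>2 / \<alpha> \<le> R x + 2 * L * D"
proof -
  define s where "s = - (m + q + w /\<^sub>R \<alpha>)"
  have sub: "R y \<ge> R (x + w) + s \<bullet> (y - (x + w))" for y
    using prox_subgradient[OF R \<alpha>, of "x - \<alpha> *\<^sub>R (m + q)" y] \<alpha>
    by (simp add: w s_def algebra_simps inner_simps)
  have s: "norm s \<le> L" using R(2) sub by (rule subgradient_norm_le)
  have \<eta>T: "\<eta> \<in> T" unfolding \<eta> using T by (rule closest_point_in_subspace)
  have "R (x + \<eta>) \<le> R (x + w) + L * norm (w - \<eta>)"
    using lipschitz_onD[OF R(2), of "x + \<eta>" "x + w"] by (auto simp: dist_norm norm_minus_commute)
  moreover have "R (x + w) \<le> R x + s \<bullet> (w - \<eta>) + s \<bullet> \<eta>"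
    using sub[of x] by (simp add: inner_simps)
  moreover have "s \<bullet> (w - \<eta>) \<le> L * norm (w - \<eta>)"
    using norm_cauchy_schwarz[of s "w - \<eta>"] mult_right_mono[OF s, of "norm (w - \<eta>)"] by simp
  moreover have "s \<bullet> \<eta> = - (m \<bullet> \<eta>) - (norm \<eta>)\<^sup>2 / \<alpha>"
  proof -
    have "w \<bullet> \<eta> = (norm \<eta>)\<^sup>2"
      using closest_point_subspace_inner[OF T \<eta>T, of w] by (simp add: \<eta> power2_norm_eq_inner)
    then show ?thesis using q[OF \<eta>T] by (simp add: s_def inner_simps divide_inverse mult.commute)
  qed
  moreover have "L * norm (w - \<eta>) \<le> L * D"
    using D lipschitz_on_nonneg[OF R(2)] by (rule mult_left_mono)
  ultimately show ?thesis by linarith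
qed

subsection \<open>Summability and expectations\<close>

text \<open>A deterministic Robbins-Siegmund lemma: telescoping bounds the sums of \<open>g\<close>,
  and \<open>V\<close> minus the partial sums of \<open>b\<close> is eventually decreasing and
  bounded below. It serves twice, for expectations and along single trajectories.\<close>

lemma perturbed_descent_convergence:
  fixes V b g :: "nat \<Rightarrow> real"
  assumes desc: "\<And>k. k \<ge> K \<Longrightarrow> V (Suc k) + g k \<le> V k + b k"
    and g: "\<And>k. g k \<ge> 0" and b: "summable b" and V: "\<And>k. V k \<ge> C"
  shows "summable g" "convergent V"
proof -
  define b' g' where "b' k = b (k + K)" and "g' k = g (k + K)" for k
  have b': "summable b'" unfolding b'_def using b by (simp add: summable_iff_shift)
  have sum_le: "V (n + K) + (\<Sum>k<n. g' k) \<le> V K + (\<Sum>k<n. b' k)" for n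
  proof (induction n)
    case (Suc n)
    then show ?case using desc[of "n + K"] by (simp add: b'_def g'_def)
  qed simp
  obtain D where D: "(\<Sum>k<n. b' k) \<le> D" for n
    using convergent_imp_Bseq[OF summable_iff_convergent[THEN iffD1, OF b']]
    unfolding Bseq_def by (auto simp: abs_le_iff)
  have "(\<Sum>k<n. g' k) \<le> V K + D - C" for n
    using sum_le[of n] D[of n] V[of "n + K"] by linarith
  then have "summable g'"
    using g by (intro summableI_nonneg_bounded[of g' "V K + D - C"]) (auto simp: g'_def)
  then show "summable g" unfolding g'_def by (simp add: summable_iff_shift)
  define W where "W n = V (n + K) - (\<Sum>k<n. b' k)" for n
  have "decseq W"
    by (rule decseq_SucI) (use desc g in \<open>simp add: W_def b'_def, smt (verit) le_add2\<close>)
  moreover have "W n \<ge> C - D" for n using V[of "n + K"] D[of n] by (simp add: W_def)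
  ultimately have "convergent W" using decseq_convergent[of W "C - D"] convergentI by metis
  then have "convergent (\<lambda>n. W n + (\<Sum>k<n. b' k))"
    using summable_iff_convergent[THEN iffD1, OF b'] by (rule convergent_add)
  then have "convergent (\<lambda>n. V (n + K))" by (simp add: W_def)
  then show "convergent V" unfolding convergent_def by (auto intro: LIMSEQ_offset)
qed

text \<open>By monotone convergence the expected sum equals the sum of the expectations; being
  finite, it forces an almost surely finite sum.\<close>

lemma AE_summable:
  fixes X :: "nat \<Rightarrow> 'w \<Rightarrow> real"
  assumes X: "\<And>k. integrable M (X k)" and nn: "\<And>k \<omega>. \<omega> \<in> space M \<Longrightarrow> X k \<omega> \<ge> 0"
    and sum: "summable (\<lambda>k. \<integral>\<omega>. X k \<omega> \<partial>M)"
  shows "AE \<omega> in M. summable (\<lambda>k. X k \<omega>)"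
proof -
  have [measurable]: "X k \<in> borel_measurable M" for k using X by auto
  have AE_nn: "AE \<omega> in M. X k \<omega> \<ge> 0" for k using nn by auto
  have "(\<integral>\<^sup>+\<omega>. (\<Sum>k. ennreal (X k \<omega>)) \<partial>M) = (\<Sum>k. \<integral>\<^sup>+\<omega>. ennreal (X k \<omega>) \<partial>M)"
    by (rule nn_integral_suminf) simp
  also have "\<dots> = (\<Sum>k. ennreal (\<integral>\<omega>. X k \<omega> \<partial>M))"
    by (intro suminf_cong nn_integral_eq_integral X AE_nn)
  also have "\<dots> = ennreal (\<Sum>k. \<integral>\<omega>. X k \<omega> \<partial>M)"
    by (rule suminf_ennreal2[OF _ sum]) (intro integral_nonneg_AE AE_nn)
  finally have "(\<integral>\<^sup>+\<omega>. (\<Sum>k. ennreal (X k \<omega>)) \<partial>M) \<noteq> \<infinity>" by simp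
  then have "AE \<omega> in M. (\<Sum>k. ennreal (X k \<omega>)) \<noteq> \<infinity>"
    by (intro nn_integral_PInf_AE) auto
  then show ?thesis
  proof (rule AE_mp, intro AE_I2 impI)
    fix \<omega> assume "\<omega> \<in> space M" "(\<Sum>k. ennreal (X k \<omega>)) \<noteq> \<infinity>"
    then show "summable (\<lambda>k. X k \<omega>)" using nn by (intro summable_suminf_not_top) auto
  qed
qed

text \<open>The tower property removes the conditional expectations. The computation stays in
  \<open>[0, \<infinity>]\<close> until every \<open>Err k\<close> is known to be integrable, and
  only then passes to real expectations.\<close>

lemma (in prob_space) error_dissipation_expectation:
  fixes e \<eta> :: "nat \<Rightarrow> 'a \<Rightarrow> 'b::euclidean_space"
  assumes diss: "error_dissipation M \<F> e \<eta> c\<^sub>e \<mu> \<nu> Err"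
    and sub: "\<And>k. subalgebra M (\<F> k)"
    and e[measurable]: "\<And>k. e k \<in> borel_measurable M"
    and \<eta>[measurable]: "\<And>k. \<eta> k \<in> borel_measurable M"
    and e_bd: "\<And>k \<omega>. \<omega> \<in> space M \<Longrightarrow> norm (e k \<omega>) \<le> K"
    and \<eta>_bd: "\<And>k \<omega>. \<omega> \<in> space M \<Longrightarrow> norm (\<eta> k \<omega>) \<le> d"
  shows "integrable M (Err k)"
    "expectation (\<lambda>\<omega>. (norm (e k \<omega>))\<^sup>2) + \<mu> * expectation (Err k) + c\<^sub>e * expectation (Err (Suc k))
      \<le> c\<^sub>e * expectation (Err k) + \<nu> * expectation (\<lambda>\<omega>. (norm (\<eta> k \<omega>))\<^sup>2)"
proof -
  note d = diss[unfolded error_dissipation_def]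
  have pos: "c\<^sub>e > 0" "\<mu> > 0" "\<nu> > 0" using d by auto
  have nn: "Err k \<omega> \<ge> 0" if "\<omega> \<in> space M" for k \<omega> using d that by blast
  have [measurable]: "Err k \<in> borel_measurable M" for k
    using d measurable_from_subalg[OF sub] by blast
  have int: "integrable M (\<lambda>\<omega>. (norm (e k \<omega>))\<^sup>2)" for k
    using e_bd by (intro integrable_const_bound[where B = "K\<^sup>2"]) (auto intro!: power_mono)
  have int': "integrable M (\<lambda>\<omega>. (norm (\<eta> k \<omega>))\<^sup>2)" for k
    using \<eta>_bd by (intro integrable_const_bound[where B = "d\<^sup>2"]) (auto intro!: power_mono)
  define N where "N f = (\<integral>\<^sup>+\<omega>. ennreal (f \<omega>) \<partial>M)" for f :: "'a \<Rightarrow> real"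
  have ineq: "N (\<lambda>\<omega>. (norm (e k \<omega>))\<^sup>2) + ennreal \<mu> * N (Err k) + ennreal c\<^sub>e * N (Err (Suc k))
      \<le> ennreal c\<^sub>e * N (Err k) + ennreal \<nu> * N (\<lambda>\<omega>. (norm (\<eta> k \<omega>))\<^sup>2)" for k
  proof -
    interpret finite_measure_subalgebra M "\<F> k" by standard (rule sub)
    have ce: "(\<integral>\<^sup>+\<omega>. nn_cond_exp M (\<F> k) f \<omega> \<partial>M) = (\<integral>\<^sup>+\<omega>. f \<omega> \<partial>M)"
      if "f \<in> borel_measurable M" for f
      using nn_cond_exp_intg[of "\<lambda>_. 1" f] that by simp
    have "(\<integral>\<^sup>+\<omega>. nn_cond_exp M (\<F> k) (\<lambda>\<omega>. ennreal ((norm (e k \<omega>))\<^sup>2)) \<omega> + ennreal (\<mu> * Err k \<omega>)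
          + ennreal c\<^sub>e * nn_cond_exp M (\<F> k) (\<lambda>\<omega>. ennreal (Err (Suc k) \<omega>)) \<omega> \<partial>M)
      \<le> (\<integral>\<^sup>+\<omega>. ennreal (c\<^sub>e * Err k \<omega>)
          + ennreal \<nu> * nn_cond_exp M (\<F> k) (\<lambda>\<omega>. ennreal ((norm (\<eta> k \<omega>))\<^sup>2)) \<omega> \<partial>M)"
      by (rule nn_integral_mono_AE) (use d in blast)
    then show ?thesis
      using pos by (simp add: nn_integral_add nn_integral_cmult ce N_def ennreal_mult')
  qed
  have fin_\<eta>: "N (\<lambda>\<omega>. (norm (\<eta> k \<omega>))\<^sup>2) < \<infinity>" for k
    unfolding N_def using int'[of k] by (subst nn_integral_eq_integral) auto
  \<comment> \<open>Only \<open>Err 0\<close> is integrable by hypothesis; the dissipation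
    inequality at \<open>k\<close> bounds the integral of \<open>Err (Suc k)\<close> by finite
    quantities.\<close>
  have fin: "N (Err k) < \<infinity>" for k
  proof (induction k)
    case 0
    have "integrable M (Err 0)" using d by blast
    then show ?case unfolding N_def using nn by (subst nn_integral_eq_integral) auto
  next
    case (Suc k)
    have "ennreal c\<^sub>e * N (Err (Suc k)) \<le> ennreal c\<^sub>e * N (Err k) + ennreal \<nu> * N (\<lambda>\<omega>. (norm (\<eta> k \<omega>))\<^sup>2)"
      by (rule order_trans[OF _ ineq]) simp
    also have "\<dots> < \<infinity>" using Suc fin_\<eta>[of k] by (simp add: ennreal_mult_less_top)
    finally show ?case using pos by (auto simp: ennreal_mult_less_top)
  qed
  have intErr: "integrable M (Err k)" for k
    using fin[of k] nn unfolding N_def by (intro integrableI_nonneg) auto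
  then show "integrable M (Err k)" .
  have N: "N f = ennreal (expectation f)" if "integrable M f" "\<And>\<omega>. \<omega> \<in> space M \<Longrightarrow> f \<omega> \<ge> 0" for f
    unfolding N_def using that by (intro nn_integral_eq_integral) auto
  have E: "expectation (Err k) \<ge> 0" for k using nn by (intro integral_nonneg_AE) auto
  have "ennreal (expectation (\<lambda>\<omega>. (norm (e k \<omega>))\<^sup>2) + \<mu> * expectation (Err k) + c\<^sub>e * expectation (Err (Suc k)))
      \<le> ennreal (c\<^sub>e * expectation (Err k) + \<nu> * expectation (\<lambda>\<omega>. (norm (\<eta> k \<omega>))\<^sup>2))"
    using ineq[of k] pos E int int' intErr nn
    by (simp add: N ennreal_mult ennreal_plus)
  then show "expectation (\<lambda>\<omega>. (norm (e k \<omega>))\<^sup>2) + \<mu> * expectation (Err k) + c\<^sub>e * expectation (Err (Suc k))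
      \<le> c\<^sub>e * expectation (Err k) + \<nu> * expectation (\<lambda>\<omega>. (norm (\<eta> k \<omega>))\<^sup>2)"
    using pos E by (subst (asm) ennreal_le_iff) auto
qed

lemma preimages_subset_sets: "X \<in> P \<rightarrow>\<^sub>M N \<Longrightarrow> preimages P N X \<subseteq> sets P"
  unfolding preimages_def by (auto intro: measurable_sets)

lemma subalgebra_history:
  assumes "\<And>k. x k \<in> borel_measurable P" "\<And>k. mbar k \<in> borel_measurable P"
      "\<And>k. u k \<in> borel_measurable P" "\<And>k. lam k \<in> borel_measurable P"
      "\<And>k. \<eta> k \<in> borel_measurable P" "\<And>k. st k \<in> P \<rightarrow>\<^sub>M N"
      "\<And>k. batch k \<in> P \<rightarrow>\<^sub>M count_space UNIV"
  shows "subalgebra P (history P N x mbar st batch u lam \<eta> k)"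
proof -
  define G where "G = (\<Union>i\<in>{0..k}. preimages P borel (x i) \<union> preimages P borel (mbar i) \<union> preimages P N (st i)) \<union>
      (\<Union>i\<in>{1..<k}. preimages P (count_space UNIV) (batch i)) \<union>
      (\<Union>i\<in>{0..<k}. preimages P borel (u i) \<union> preimages P borel (lam i) \<union> preimages P borel (\<eta> i))"
  have "G \<subseteq> sets P" unfolding G_def
    by (intro Un_least UN_least preimages_subset_sets assms)
  then show ?thesis
    unfolding subalgebra_def history_def G_def[symmetric]
    using sets.sigma_sets_subset[of G P] sets.space_closed[of P] by (auto simp: space_measure_of_conv sets_measure_of)
qed

lemma gradient_finite_average:
  fixes f :: "nat \<Rightarrow> 'a::euclidean_space \<Rightarrow> real"
  assumes F: "F = (\<lambda>y. (1 / real n) * (\<Sum>j=1..n. f j y))"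
    and f: "\<And>j. j \<in> {1..n} \<Longrightarrow> f j differentiable (at y)"
  shows "GDERIV F y :> (1 / real n) *\<^sub>R (\<Sum>j=1..n. gradient (f j) y)"
proof -
  have "(f j has_derivative (\<lambda>h. h \<bullet> gradient (f j) y)) (at y)" if "j \<in> {1..n}" for j
    using GDERIV_gradient[OF f[OF that]] unfolding gderiv_def .
  then show ?thesis
    unfolding gderiv_def F inner_scaleR_right inner_sum_right
    by (intro has_derivative_mult_right has_derivative_sum)
qed

lemma norm_finite_average_le:
  fixes g :: "nat \<Rightarrow> 'a::real_normed_vector"
  assumes n: "n \<ge> 1" and g: "\<And>j. j \<in> {1..n} \<Longrightarrow> norm (g j) \<le> K"
  shows "norm ((1 / real n) *\<^sub>R (\<Sum>j=1..n. g j)) \<le> K"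
proof -
  have "norm (\<Sum>j=1..n. g j) \<le> (\<Sum>j=1..n. K)" by (rule sum_norm_le) (rule g)
  then show ?thesis using n by (simp add: field_simps)
qed

text \<open>Explains \<open>C\<^sub>\<alpha>\<close>: with \<open>S = M\<^sub>u + l\<^sub>R\<close>
  and \<open>D = l\<^sub>R * C\<^sub>0 * \<Delta>\<^sub>b\<close>, the bound on \<alpha> is
  \<open>S * sqrt \<alpha> + sqrt D < sqrt (D + S * d)\<close>. Squared, it reads
  \<open>S * \<alpha> + 2 * sqrt (\<alpha> * D) < d\<close>, and a \<open>t\<close> beyond the
  left-hand side violates the quadratic inequality.\<close>

lemma step_size_bound:
  fixes t S D \<alpha> d :: real
  assumes pos: "\<alpha> > 0" "S > 0" "D \<ge> 0" "d > 0" "t \<ge> 0"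
    and \<alpha>: "\<alpha> < ((sqrt (D + S * d) - sqrt D) / S)\<^sup>2"
    and t: "t\<^sup>2 / \<alpha> \<le> S * t + 2 * D"
  shows "t < d"
proof (rule ccontr)
  assume "\<not> t < d"
  define r p q where "r = sqrt \<alpha>" and "p = sqrt D" and "q = sqrt (D + S * d)"
  have r: "r > 0" "r\<^sup>2 = \<alpha>" and p: "p \<ge> 0" "p\<^sup>2 = D" and q: "q \<ge> 0" "q\<^sup>2 = D + S * d"
    using pos by (auto simp: r_def p_def q_def)
  have "p \<le> q" unfolding p_def q_def using pos by simp
  then have "r < (q - p) / S"
    using \<alpha> pos r(2) unfolding p_def[symmetric] q_def[symmetric]
    by (intro power_less_imp_less_base[of r 2]) auto
  then have "S * r + p < q" using pos by (simp add: field_simps)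
  then have "(S * r + p)\<^sup>2 < q\<^sup>2" using pos r p by (intro power_strict_mono) auto
  then have "S * (S * r\<^sup>2 + 2 * (r * p)) < S * d"
    using p(2) q(2) by (simp add: power2_eq_square algebra_simps)
  then have "S * r\<^sup>2 + 2 * (r * p) < t" using pos \<open>\<not> t < d\<close> by simp
  moreover have rp: "0 \<le> r * p" "0 \<le> S * r\<^sup>2" using pos r p by auto
  ultimately have "(2 * (r * p)) * (2 * (r * p)) < (t - S * r\<^sup>2) * t"
    by (intro mult_strict_mono') auto
  also have "\<dots> \<le> 2 * (r * p)\<^sup>2"
  proof -
    have "t\<^sup>2 \<le> r\<^sup>2 * (S * t + 2 * p\<^sup>2)"
      using t pos r p by (simp add: field_simps)
    then show ?thesis by (simp add: power2_eq_square algebra_simps)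
  qed
  also have "2 * (r * p)\<^sup>2 \<le> (2 * (r * p)) * (2 * (r * p))"
    using zero_le_power2[of "r * p"] by (simp only: power2_eq_square)
  finally show False by simp
qed

lemma young_inner_le:
  fixes x y :: "'a::real_inner"
  assumes "c > 0"
  shows "- (x \<bullet> y) \<le> (norm x)\<^sup>2 / (2 * c) + c / 2 * (norm y)\<^sup>2"
proof -
  have "0 \<le> (norm (x + c *\<^sub>R y))\<^sup>2 / (2 * c)" using assms by simp
  also have "\<dots> = (norm x)\<^sup>2 / (2 * c) + x \<bullet> y + c / 2 * (norm y)\<^sup>2"
    using assms unfolding power2_norm_eq_inner
    by (simp add: inner_simps inner_commute field_simps power2_eq_square)
  finally show ?thesis by simp
qed

text \<open>Shifting by \<open>k\<^sub>0\<close> discards the finitely many terms whose base is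
  negative.\<close>

lemma summable_shifted_powr:
  assumes "r > 1"
  shows "summable (\<lambda>k. (real k - real k\<^sub>0) powr (- r))"
proof -
  have "summable (\<lambda>k. (real (k + k\<^sub>0) - real k\<^sub>0) powr (- r))"
    using assms by (simp add: summable_real_powr_iff)
  then show ?thesis by (rule summable_iff_shift[THEN iffD1])
qed

subsection \<open>The convergence result\<close>

theorem lemma4p9:
  fixes M U :: "'a::euclidean_space set"
    and f :: "nat \<Rightarrow> 'a \<Rightarrow> real" and n :: nat and F R \<Phi> :: "'a \<Rightarrow> real"
    and l\<^sub>f l\<^sub>R M\<^sub>f c\<^sub>f M\<^sub>u :: real
    and Retr :: "'a \<Rightarrow> 'a \<Rightarrow> 'a"
    and I :: "nat set" and V Uloc :: "nat \<Rightarrow> 'a set"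
    and \<psi> :: "nat \<Rightarrow> 'a \<Rightarrow> 'b::euclidean_space" and ell :: "'a \<Rightarrow> nat" and B :: "'a \<Rightarrow> 'a \<Rightarrow> 'b"
    and \<delta> C\<^sub>R C\<^sub>Q L\<^sub>R L\<^sub>\<Phi> L\<^sub>F \<delta>\<^sub>T L\<^sub>T C\<^sub>0 C\<^sub>1 C\<^sub>\<alpha> :: real
    and \<alpha> \<alpha>\<^sub>b \<gamma>\<^sub>0 \<Delta>\<^sub>b chi\<^sub>b :: real
    and P :: "'w measure" and N :: "'s measure"
    and \<gamma> \<Delta> chi :: "nat \<Rightarrow> 'w \<Rightarrow> real"
    and x\<^sub>0 :: 'a
    and st :: "nat \<Rightarrow> 'w \<Rightarrow> 's" and batch :: "nat \<Rightarrow> 'w \<Rightarrow> nat multiset"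
    and est :: "nat \<Rightarrow> 'a \<Rightarrow> 's \<Rightarrow> nat multiset \<Rightarrow> 'a"
    and x u uhat mbar m w \<eta> \<eta>hat e :: "nat \<Rightarrow> 'w \<Rightarrow> 'a" and lam :: "nat \<Rightarrow> 'w \<Rightarrow> 'b"
    and \<F> :: "nat \<Rightarrow> 'w measure"
    and c\<^sub>e \<mu> \<nu> :: real and Err :: "nat \<Rightarrow> 'w \<Rightarrow> real"
    and \<kappa>\<^sub>1 \<kappa>\<^sub>2 r \<rho>\<^sub>1 \<rho>\<^sub>2 chi\<^sub>e a c\<^sub>\<eta> C\<^sub>s\<^sub>h d\<^sub>\<alpha> :: real and k\<^sub>0 :: nat
  \<comment> \<open>manifold\<close>
  assumes M_compact: "compact M"
    and cover: "finite I" "M \<subseteq> (\<Union>i\<in>I. V i)"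
      "\<And>i. i \<in> I \<Longrightarrow> open (V i) \<and> closure (V i) \<subseteq> Uloc i \<and> local_defining_function M (Uloc i) (\<psi> i)"
    and ell: "\<And>y. y \<in> M \<Longrightarrow> ell y \<in> I \<and> y \<in> V (ell y)"
    and B_eq: "\<And>y. y \<in> M \<Longrightarrow> B y = frechet_derivative (\<psi> (ell y)) (at y)"
    and C0: "C\<^sub>0 > 0" "\<And>y v. y \<in> M \<Longrightarrow> infdist v (tangent_space M y) \<le> C\<^sub>0 * norm (B y v)"
    and Retr: "smooth_retraction M Retr"
  \<comment> \<open>objective\<close>
    and n: "n \<ge> 1"
    and F_eq: "F = (\<lambda>y. (1 / real n) * (\<Sum>j=1..n. f j y))"
    and Phi_eq: "\<Phi> = (\<lambda>y. F y + R y)"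
    and f_C1: "\<And>j. j \<in> {1..n} \<Longrightarrow>
      (\<forall>y. f j differentiable (at y)) \<and> continuous_on UNIV (gradient (f j))"
    and U: "open U" "M \<subseteq> U"
    and f_Lip: "\<And>j. j \<in> {1..n} \<Longrightarrow> l\<^sub>f-lipschitz_on U (gradient (f j))"
    and Mf: "M\<^sub>f > 0" "\<And>j y. j \<in> {1..n} \<Longrightarrow> y \<in> M \<Longrightarrow> norm (gradient (f j) y) \<le> M\<^sub>f"
    and R_convex: "convex_on UNIV R"
    and R_Lip: "l\<^sub>R-lipschitz_on UNIV R"
  \<comment> \<open>constants\<close>
    and const_pos: "\<delta> > 0" "C\<^sub>R > 0" "C\<^sub>Q > 0" "L\<^sub>R > 0" "L\<^sub>\<Phi> > 0" "L\<^sub>F > 0" "\<delta>\<^sub>T > 0" "L\<^sub>T > 0"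
    and tube: "\<And>y \<zeta>. y \<in> M \<Longrightarrow> \<zeta> \<in> tangent_space M y \<Longrightarrow> norm \<zeta> \<le> \<delta> \<Longrightarrow> y + \<zeta> \<in> U"
    and geometry_bounds: "\<And>y \<zeta>. y \<in> M \<Longrightarrow> \<zeta> \<in> tangent_space M y \<Longrightarrow> norm \<zeta> \<le> \<delta> \<Longrightarrow>
      norm (Retr y \<zeta> - y) \<le> C\<^sub>R * norm \<zeta> \<and>
      norm (Retr y \<zeta> - y - \<zeta>) \<le> C\<^sub>Q * (norm \<zeta>)\<^sup>2 \<and>
      \<bar>R (Retr y \<zeta>) - R (y + \<zeta>)\<bar> \<le> L\<^sub>R * (norm \<zeta>)\<^sup>2 \<and>
      \<bar>\<Phi> (Retr y \<zeta>) - \<Phi> (y + \<zeta>)\<bar> \<le> L\<^sub>\<Phi> * (norm \<zeta>)\<^sup>2 \<and>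
      F (Retr y \<zeta>) - F y - riem_grad M F y \<bullet> \<zeta> \<le> L\<^sub>F / 2 * (norm \<zeta>)\<^sup>2"
    and LT_single: "\<And>h y \<zeta>. h \<in> insert F (f ` {1..n}) \<Longrightarrow> y \<in> M \<Longrightarrow> \<zeta> \<in> tangent_space M y \<Longrightarrow>
      norm \<zeta> \<le> \<delta>\<^sub>T \<Longrightarrow>
      norm (riem_grad M h (Retr y \<zeta>)
        - closest_point (tangent_space M (Retr y \<zeta>)) (riem_grad M h y)) \<le> L\<^sub>T * norm \<zeta>"
    and LT_chain: "\<And>h i y \<zeta>. h \<in> insert F (f ` {1..n}) \<Longrightarrow>
      (\<And>k::nat. k \<le> i \<Longrightarrow> y k \<in> M) \<Longrightarrow>
      (\<And>k::nat. k < i \<Longrightarrow>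
        \<zeta> k \<in> tangent_space M (y k) \<and> norm (\<zeta> k) \<le> \<delta>\<^sub>T \<and> y (Suc k) = Retr (y k) (\<zeta> k)) \<Longrightarrow>
      norm (riem_grad M h (y i) - closest_point (tangent_space M (y i)) (riem_grad M h (y 0)))
        \<le> L\<^sub>T * (\<Sum>k<i. norm (\<zeta> k))"
    and C_alpha: "C\<^sub>\<alpha> = ((sqrt (l\<^sub>R * C\<^sub>0 * \<Delta>\<^sub>b + (M\<^sub>u + l\<^sub>R) * min \<delta> \<delta>\<^sub>T) - sqrt (l\<^sub>R * C\<^sub>0 * \<Delta>\<^sub>b))
      / (M\<^sub>u + l\<^sub>R))\<^sup>2"
  \<comment> \<open>algorithm: parameters and randomness\<close>
    and params: "0 < \<alpha>" "\<alpha> \<le> \<alpha>\<^sub>b" "0 < \<gamma>\<^sub>0" "\<gamma>\<^sub>0 \<le> 1" "\<Delta>\<^sub>b \<ge> 0" "0 \<le> chi\<^sub>b" "chi\<^sub>b < 1"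
      "c\<^sub>f \<ge> 1" "M\<^sub>u = c\<^sub>f * M\<^sub>f"
    and P: "prob_space P"
    and random_variables:
      "\<And>k. x k \<in> borel_measurable P" "\<And>k. mbar k \<in> borel_measurable P"
      "\<And>k. u k \<in> borel_measurable P" "\<And>k. lam k \<in> borel_measurable P"
      "\<And>k. \<eta> k \<in> borel_measurable P" "\<And>k. st k \<in> P \<rightarrow>\<^sub>M N"
      "\<And>k. batch k \<in> P \<rightarrow>\<^sub>M count_space UNIV"
    and filtration: "\<And>k. \<F> k = history P N x mbar st batch u lam \<eta> k"
    and params_measurable: "\<And>k. \<gamma> k \<in> borel_measurable (\<F> k)"
      "\<And>k. \<Delta> k \<in> borel_measurable (\<F> k)" "\<And>k. chi k \<in> borel_measurable (\<F> k)"
    and params_range: "\<And>k \<omega>. \<omega> \<in> space P \<Longrightarrow>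
      \<gamma> k \<omega> \<in> {\<gamma>\<^sub>0..1} \<and> \<Delta> k \<omega> \<in> {0..\<Delta>\<^sub>b} \<and> chi k \<omega> \<in> {0..chi\<^sub>b}"
  \<comment> \<open>algorithm: recursion\<close>
    and init: "x\<^sub>0 \<in> M" "\<And>\<omega>. \<omega> \<in> space P \<Longrightarrow>
      x 0 \<omega> = x\<^sub>0 \<and> u 0 \<omega> = riem_grad M F x\<^sub>0 \<and> uhat 0 \<omega> = riem_grad M F x\<^sub>0 \<and>
      mbar 0 \<omega> = riem_grad M F x\<^sub>0"
    and step_a: "\<And>k \<omega>. k \<noteq> 0 \<Longrightarrow> \<omega> \<in> space P \<Longrightarrow>
      set_mset (batch k \<omega>) \<subseteq> {1..n} \<and> u k \<omega> = est k (x k \<omega>) (st k \<omega>) (batch k \<omega>) \<and>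
      u k \<omega> \<in> tangent_space M (x k \<omega>) \<and> uhat k \<omega> = closest_point (cball 0 M\<^sub>u) (u k \<omega>)"
    and step_b: "\<And>k \<omega>. \<omega> \<in> space P \<Longrightarrow>
      m k \<omega> = chi k \<omega> *\<^sub>R mbar k \<omega> + (1 - chi k \<omega>) *\<^sub>R uhat k \<omega>"
    and step_c: "\<And>k \<omega>. \<omega> \<in> space P \<Longrightarrow>
      norm (gradient (dual_function \<alpha> R (x k \<omega>) (m k \<omega>) (B (x k \<omega>))) (lam k \<omega>)) \<le> \<Delta> k \<omega>"
    and step_d: "\<And>k \<omega>. \<omega> \<in> space P \<Longrightarrow>
      w k \<omega> = prox (\<lambda>y. \<alpha> * R y)
        (x k \<omega> - \<alpha> *\<^sub>R (m k \<omega> + adjoint (B (x k \<omega>)) (lam k \<omega>))) - x k \<omega> \<and>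
      \<eta> k \<omega> = closest_point (tangent_space M (x k \<omega>)) (w k \<omega>)"
    and step_e: "\<And>k \<omega>. \<omega> \<in> space P \<Longrightarrow> x (Suc k) \<omega> = Retr (x k \<omega>) (\<gamma> k \<omega> *\<^sub>R \<eta> k \<omega>)"
    and step_f: "\<And>k \<omega>. \<omega> \<in> space P \<Longrightarrow>
      mbar (Suc k) \<omega> = closest_point (tangent_space M (x (Suc k) \<omega>)) (m k \<omega>)"
    and eta_hat: "\<And>k \<omega>. \<omega> \<in> space P \<Longrightarrow>
      \<eta>hat k \<omega> = arg_min_on (tangent_model \<alpha> R (x k \<omega>) (m k \<omega>)) (tangent_space M (x k \<omega>))"
    and e_eq: "\<And>k \<omega>. \<omega> \<in> space P \<Longrightarrow> e k \<omega> = m k \<omega> - riem_grad M F (x k \<omega>)"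
    and C1: "C\<^sub>1 > 0"
      "\<And>k \<omega>. \<omega> \<in> space P \<Longrightarrow> norm (\<eta> k \<omega> - \<eta>hat k \<omega>) \<le> C\<^sub>1 * sqrt (\<Delta> k \<omega>)"
  \<comment> \<open>hypotheses of the result\<close>
    and full_step: "\<And>k \<omega>. \<omega> \<in> space P \<Longrightarrow> \<gamma> k \<omega> = 1"
    and dissipation: "error_dissipation P \<F> e \<eta> c\<^sub>e \<mu> \<nu> Err"
    and kappa: "\<kappa>\<^sub>1 \<ge> 0" "\<kappa>\<^sub>2 \<ge> 0" and r: "r > 2"
    and Delta: "\<And>k \<omega>. \<omega> \<in> space P \<Longrightarrow> k \<ge> k\<^sub>0 + 1 \<Longrightarrow>
      \<Delta> k \<omega> \<le> min \<Delta>\<^sub>b (max (\<kappa>\<^sub>1 * (norm (\<eta> (k - 1) \<omega>))\<^sup>2) (\<kappa>\<^sub>2 * (real k - real k\<^sub>0) powr (- r)))"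
    and rho: "\<rho>\<^sub>1 > 0" "\<rho>\<^sub>2 > 0" and chi_e: "chi\<^sub>e > \<rho>\<^sub>1"
    and a: "a = 1 / (2 * \<alpha>) - l\<^sub>f / 2 - \<rho>\<^sub>2 / 2"
    and c_eta: "c\<^sub>\<eta> = 1 / (4 * \<alpha>) + l\<^sub>f\<^sup>2 * \<rho>\<^sub>1 + 2 * L\<^sub>\<Phi>"
    and C_sh: "C\<^sub>s\<^sub>h = C\<^sub>1\<^sup>2 / \<alpha> + 2 * L\<^sub>\<Phi> * C\<^sub>1\<^sup>2 + C\<^sub>1\<^sup>2 / (2 * \<rho>\<^sub>1) + 2 * C\<^sub>0 * l\<^sub>R"
    and d_alpha: "d\<^sub>\<alpha> = a - c\<^sub>\<eta>"
    and alpha_bar: "0 < \<alpha>\<^sub>b"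
      "\<alpha>\<^sub>b < Min {C\<^sub>\<alpha>, 1 / (l\<^sub>f + \<rho>\<^sub>2),
        1 / (2 * l\<^sub>f + 2 * \<rho>\<^sub>2 + 4 * l\<^sub>f\<^sup>2 * \<rho>\<^sub>1 + 8 * L\<^sub>\<Phi> + 8 * \<nu> / \<rho>\<^sub>2 + 16 * chi\<^sub>e * \<nu>)}"
    and kappa1: "\<kappa>\<^sub>1 < (d\<^sub>\<alpha> / 4 - \<nu> / (2 * \<rho>\<^sub>2) - chi\<^sub>e * \<nu>) / (d\<^sub>\<alpha> * C\<^sub>1\<^sup>2 / 2 + C\<^sub>s\<^sub>h)"
  shows "(\<exists>\<Phi>lim \<in> borel_measurable P.
            AE \<omega> in P. (\<lambda>k. shifted_objective M \<Phi> (x k \<omega>) (\<eta>hat k \<omega>)) \<longlonglongrightarrow> ereal (\<Phi>lim \<omega>)) \<and>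
         (AE \<omega> in P. (\<lambda>k. \<eta>hat k \<omega>) \<longlonglongrightarrow> 0 \<and> (\<lambda>k. \<eta> k \<omega>) \<longlonglongrightarrow> 0 \<and>
            (\<lambda>k. e k \<omega>) \<longlonglongrightarrow> 0 \<and> (\<lambda>k. Err k \<omega>) \<longlonglongrightarrow> 0) \<and>
         (AE \<omega> in P. \<forall>z. (\<exists>s. strict_mono s \<and> (\<lambda>i. x (s i) \<omega>) \<longlonglongrightarrow> z) \<longrightarrow> critical_point M F R z)"
  proof -
  interpret prob_space P by (rule P)
  interpret embedded_submanifold M I V Uloc \<psi> ell B C\<^sub>0 Retr
    by unfold_locales (fact M_compact cover ell B_eq C0 Retr)+
  define T where "T = tangent_space M"
  define \<Omega> where "\<Omega> = space P"
  have T: "subspace (T y)" if "y \<in> M" for y using subspace_tangent_space[OF that] by (simp add: T_def)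
  have l\<^sub>R: "l\<^sub>R \<ge> 0" using R_Lip by (rule lipschitz_on_nonneg)
  have l\<^sub>f: "l\<^sub>f \<ge> 0" using f_Lip[of 1] n by (auto intro: lipschitz_on_nonneg)
  have M\<^sub>u: "M\<^sub>f \<le> M\<^sub>u" "M\<^sub>u > 0" using params Mf(1) mult_right_mono[of 1 c\<^sub>f M\<^sub>f] by auto

  \<comment> \<open>Regularity and bounds of the objective\<close>
  have gF_eq: "gradient F y = (1 / real n) *\<^sub>R (\<Sum>j=1..n. gradient (f j) y)" for y
    by (rule gradient_eq, rule gradient_finite_average[OF F_eq]) (use f_C1 in blast)
  have gF: "GDERIV F y :> gradient F y" for y
    unfolding gF_eq by (rule gradient_finite_average[OF F_eq]) (use f_C1 in blast)
  have F_cont: "continuous_on A F" for A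
    using gF has_derivative_continuous unfolding gderiv_def
    by (intro continuous_at_imp_continuous_on) blast
  have gF_cont: "continuous_on A (gradient F)" for A
    unfolding gF_eq using f_C1
    by (intro continuous_intros) (blast intro: continuous_on_subset)
  have gF_lip: "l\<^sub>f-lipschitz_on U (gradient F)"
  proof (rule lipschitz_onI)
    fix y z assume yz: "y \<in> U" "z \<in> U"
    have "norm ((1 / real n) *\<^sub>R (\<Sum>j=1..n. gradient (f j) y - gradient (f j) z)) \<le> l\<^sub>f * dist y z"
      using lipschitz_onD[OF f_Lip yz] by (intro norm_finite_average_le n) (simp add: dist_norm)
    then show "dist (gradient F y) (gradient F z) \<le> l\<^sub>f * dist y z"
      unfolding gF_eq dist_norm by (simp add: sum_subtractf scaleR_diff_right)
  qed (rule l\<^sub>f)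
  \<comment> \<open>On tangent vectors the Riemannian and the Euclidean gradient act alike, so
    estimates for the Euclidean one suffice.\<close>
  have rg_inner: "riem_grad M F y \<bullet> v = gradient F y \<bullet> v" if "y \<in> M" "v \<in> T y" for y v
    unfolding riem_grad_def using that T by (simp add: T_def closest_point_subspace_inner)
  have rg_le: "norm (riem_grad M F y) \<le> M\<^sub>u" if "y \<in> M" for y
  proof -
    have "norm (gradient F y) \<le> M\<^sub>f"
      unfolding gF_eq using Mf(2) that by (intro norm_finite_average_le n) auto
    then show ?thesis unfolding riem_grad_def
      using closest_point_subspace_norm_le[OF T[OF that], of "gradient F y"] M\<^sub>u by (simp add: T_def)
  qed
  have rg_cont: "continuous_on M (riem_grad M F)"
    unfolding riem_grad_def by (intro continuous_on_closest_tangent gF_cont)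
  have R_cont: "continuous_on A R" for A
    using lipschitz_on_continuous_on[OF R_Lip] continuous_on_subset by blast
  have \<Phi>_cont: "continuous_on A \<Phi>" for A
    unfolding Phi_eq by (intro continuous_intros F_cont R_cont)

  \<comment> \<open>Bounds along every trajectory\<close>
  have iter: "x k \<omega> \<in> M \<and> \<eta> k \<omega> \<in> T (x k \<omega>)" if \<omega>: "\<omega> \<in> \<Omega>" for k \<omega>
  proof (induction k)
    case 0
    show ?case using init \<omega> step_d[of \<omega> 0] T closest_point_in_subspace by (auto simp: \<Omega>_def T_def)
  next
    case (Suc k)
    have "x (Suc k) \<omega> = Retr (x k \<omega>) (\<eta> k \<omega>)"
      using step_e full_step \<omega> by (simp add: \<Omega>_def)
    moreover have "(x k \<omega>, \<eta> k \<omega>) \<in> tangent_bundle M"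
      using Suc by (simp add: tangent_bundle_def T_def)
    ultimately have "x (Suc k) \<omega> \<in> M" using Retr unfolding smooth_retraction_def by fastforce
    then show ?case using \<omega> step_d[of \<omega> "Suc k"] T closest_point_in_subspace by (auto simp: \<Omega>_def T_def)
  qed
  then have xM: "x k \<omega> \<in> M" and \<eta>T: "\<eta> k \<omega> \<in> T (x k \<omega>)" if "\<omega> \<in> \<Omega>" for k \<omega>
    using that by blast+
  \<comment> \<open>Nothing is truncated at index 0; there \<open>c\<^sub>f \<ge> 1\<close> ensures
    that the exact gradient lies in the ball of radius \<open>M\<^sub>u\<close>.\<close>
  have uhat_le: "norm (uhat k \<omega>) \<le> M\<^sub>u" if "\<omega> \<in> \<Omega>" for k \<omega>
  proof (cases "k = 0")
    case True then show ?thesis using init that rg_le by (simp add: \<Omega>_def)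
  next
    case False
    have "closest_point (cball 0 M\<^sub>u) (u k \<omega>) \<in> cball 0 M\<^sub>u"
      using M\<^sub>u by (intro closest_point_in_set) auto
    then show ?thesis using step_a[OF False] that by (simp add: \<Omega>_def)
  qed
  have m_of_mbar: "norm (m k \<omega>) \<le> M\<^sub>u" if \<omega>: "\<omega> \<in> \<Omega>" and mb: "norm (mbar k \<omega>) \<le> M\<^sub>u" for k \<omega>
  proof -
    have c: "0 \<le> chi k \<omega>" "chi k \<omega> \<le> 1" using params_range[of \<omega> k] \<omega> params by (auto simp: \<Omega>_def)
    have "norm (m k \<omega>) \<le> chi k \<omega> * norm (mbar k \<omega>) + (1 - chi k \<omega>) * norm (uhat k \<omega>)"
      using step_b[of \<omega> k] \<omega> c norm_triangle_ineq[of "chi k \<omega> *\<^sub>R mbar k \<omega>" "(1 - chi k \<omega>) *\<^sub>R uhat k \<omega>"]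
      by (simp add: \<Omega>_def)
    also have "\<dots> \<le> chi k \<omega> * M\<^sub>u + (1 - chi k \<omega>) * M\<^sub>u"
      using c mb uhat_le[OF \<omega>] by (intro add_mono mult_left_mono) auto
    finally show ?thesis by (simp add: algebra_simps)
  qed
  \<comment> \<open>Tangent projections do not increase norms and convex combinations stay in a
    ball, so the bound survives transport and momentum.\<close>
  have m_le: "norm (m k \<omega>) \<le> M\<^sub>u" if \<omega>: "\<omega> \<in> \<Omega>" for k \<omega>
  proof -
    have "norm (mbar k \<omega>) \<le> M\<^sub>u"
    proof (induction k)
      case 0 show ?case using init \<omega> rg_le by (simp add: \<Omega>_def)
    next
      case (Suc k)
      show ?case
        using step_f[of \<omega> k] closest_point_subspace_norm_le[OF T[OF xM[OF \<omega>, of "Suc k"]], of "m k \<omega>"]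
          m_of_mbar[OF \<omega> Suc] \<omega> by (simp add: \<Omega>_def T_def)
    qed
    then show ?thesis using m_of_mbar \<omega> by blast
  qed

  have \<Delta>_range: "0 \<le> \<Delta> k \<omega>" "\<Delta> k \<omega> \<le> \<Delta>\<^sub>b" if "\<omega> \<in> \<Omega>" for k \<omega>
    using params_range[of \<omega> k] that by (auto simp: \<Omega>_def)
  have step: "R (x k \<omega> + \<eta> k \<omega>) + m k \<omega> \<bullet> \<eta> k \<omega> + (norm (\<eta> k \<omega>))\<^sup>2 / \<alpha>
      \<le> R (x k \<omega>) + 2 * l\<^sub>R * (C\<^sub>0 * \<Delta> k \<omega>)" if \<omega>: "\<omega> \<in> \<Omega>" for k \<omega>
  proof (rule inexact_proximal_step[OF R_convex R_Lip params(1) T[OF xM[OF \<omega>]]])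
    have lin: "linear (B (x k \<omega>))" using linear_B[OF xM[OF \<omega>]] .
    show "w k \<omega> = prox (\<lambda>y. \<alpha> * R y)
        (x k \<omega> - \<alpha> *\<^sub>R (m k \<omega> + adjoint (B (x k \<omega>)) (lam k \<omega>))) - x k \<omega>"
      using step_d \<omega> by (simp add: \<Omega>_def)
    \<comment> \<open>The dual gradient is \<open>- B w\<close>: the tolerance bounds
      \<open>B w\<close>, and \<open>C\<^sub>0\<close> turns this into a bound on the distance from
      \<open>w\<close> to the tangent space.\<close>
    from gradient_dual_function[OF R_convex R_Lip params(1) lin this]
    have "norm (B (x k \<omega>) (w k \<omega>)) \<le> \<Delta> k \<omega>" using step_c[of \<omega> k] \<omega> by (simp add: \<Omega>_def)
    then have "C\<^sub>0 * norm (B (x k \<omega>) (w k \<omega>)) \<le> C\<^sub>0 * \<Delta> k \<omega>"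
      using C0(1) by (intro mult_left_mono) auto
    moreover show \<eta>_eq: "\<eta> k \<omega> = closest_point (T (x k \<omega>)) (w k \<omega>)"
      using step_d \<omega> by (simp add: \<Omega>_def T_def)
    ultimately show "norm (w k \<omega> - \<eta> k \<omega>) \<le> C\<^sub>0 * \<Delta> k \<omega>"
      using dist_closest_tangent_le[OF xM[OF \<omega>], of "w k \<omega>" k] by (simp add: T_def)
    show "adjoint (B (x k \<omega>)) (lam k \<omega>) \<bullet> v = 0" if "v \<in> T (x k \<omega>)" for v
      using that tangent_space_eq_kernel[OF xM[OF \<omega>]] adjoint_works[OF lin, of v]
      by (simp add: T_def inner_commute)
  qed

  define d where "d = min \<delta> \<delta>\<^sub>T"
  \<comment> \<open>The step inequality, the Lipschitz bound of \<open>R\<close> and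
    \<open>norm (m k \<omega>) \<le> M\<^sub>u\<close> give a quadratic inequality for the step
    length, to which \<open>\<alpha> < C\<^sub>\<alpha>\<close> applies.\<close>
  have \<eta>_le: "norm (\<eta> k \<omega>) \<le> d" if \<omega>: "\<omega> \<in> \<Omega>" for k \<omega>
  proof (rule less_imp_le, rule step_size_bound[OF params(1)])
    show "M\<^sub>u + l\<^sub>R > 0" "l\<^sub>R * C\<^sub>0 * \<Delta>\<^sub>b \<ge> 0" "d > 0"
      using M\<^sub>u l\<^sub>R C0(1) params const_pos by (auto simp: d_def)
    show "\<alpha> < ((sqrt (l\<^sub>R * C\<^sub>0 * \<Delta>\<^sub>b + (M\<^sub>u + l\<^sub>R) * d) - sqrt (l\<^sub>R * C\<^sub>0 * \<Delta>\<^sub>b)) / (M\<^sub>u + l\<^sub>R))\<^sup>2"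
      using alpha_bar params C_alpha by (simp add: d_def)
    have "R (x k \<omega>) - R (x k \<omega> + \<eta> k \<omega>) \<le> l\<^sub>R * norm (\<eta> k \<omega>)"
      using lipschitz_onD[OF R_Lip, of "x k \<omega>" "x k \<omega> + \<eta> k \<omega>"] by (auto simp: dist_norm)
    moreover have "- (m k \<omega> \<bullet> \<eta> k \<omega>) \<le> M\<^sub>u * norm (\<eta> k \<omega>)"
      using norm_cauchy_schwarz[of "- m k \<omega>" "\<eta> k \<omega>"] mult_right_mono[OF m_le[OF \<omega>, of k], of "norm (\<eta> k \<omega>)"]
      by simp
    moreover have "l\<^sub>R * (C\<^sub>0 * \<Delta> k \<omega>) \<le> l\<^sub>R * (C\<^sub>0 * \<Delta>\<^sub>b)"
      using l\<^sub>R C0(1) \<Delta>_range[OF \<omega>] by (intro mult_left_mono) auto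
    ultimately show "(norm (\<eta> k \<omega>))\<^sup>2 / \<alpha> \<le> (M\<^sub>u + l\<^sub>R) * norm (\<eta> k \<omega>) + 2 * (l\<^sub>R * C\<^sub>0 * \<Delta>\<^sub>b)"
      using step[OF \<omega>, of k] by (simp add: algebra_simps)
  qed simp

  \<comment> \<open>Coefficients and the one-step descent inequality\<close>
  define c where "c = 2 * C\<^sub>0 * l\<^sub>R"
  \<comment> \<open>Gain of the proximal step, less the losses from the descent lemma, from Young's
    inequality with weight \<open>\<rho>\<^sub>2\<close>, and from the retraction.\<close>
  define p where "p = 1 / \<alpha> - l\<^sub>f / 2 - \<rho>\<^sub>2 / 2 - L\<^sub>\<Phi>"
  \<comment> \<open>The first summand absorbs the error term of Young's inequality; the second
    leaves \<open>chi\<^sub>e\<close> times the squared error to be summed.\<close>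
  define \<theta> where "\<theta> = 1 / (2 * \<rho>\<^sub>2) + chi\<^sub>e"
  have diss_pos: "c\<^sub>e > 0" "\<mu> > 0" "\<nu> > 0" using dissipation by (auto simp: error_dissipation_def)
  have c: "c \<ge> 0" unfolding c_def using C0(1) l\<^sub>R by simp
  have \<theta>: "\<theta> > 0" unfolding \<theta>_def using rho chi_e by (simp add: add_pos_pos)
  \<comment> \<open>Here \<open>1 / Z\<close> is the last entry of the bound on
    \<open>\<alpha>\<^sub>b\<close>, so \<open>d\<^sub>\<alpha> > 0\<close>. With
    \<open>p \<ge> d\<^sub>\<alpha>\<close> and \<open>c \<le> C\<^sub>s\<^sub>h\<close>, the bound
    on \<open>\<kappa>\<^sub>1\<close> yields \<open>c * \<kappa>\<^sub>1 < d\<^sub>\<alpha> / 4 -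
    \<theta> * \<nu>\<close>, hence the margin.\<close>
  have margin: "p - \<theta> * \<nu> - c * \<kappa>\<^sub>1 > 0" "p \<ge> 0"
  proof -
    define Z where "Z = 2 * l\<^sub>f + 2 * \<rho>\<^sub>2 + 4 * l\<^sub>f\<^sup>2 * \<rho>\<^sub>1 + 8 * L\<^sub>\<Phi> + 8 * \<nu> / \<rho>\<^sub>2 + 16 * chi\<^sub>e * \<nu>"
    have Z: "Z > 0" unfolding Z_def using l\<^sub>f rho const_pos diss_pos chi_e
      by (intro add_pos_pos add_nonneg_pos) auto
    have "\<alpha> < 1 / Z" using alpha_bar params by (simp add: Z_def)
    then have Z_less: "Z < 1 / \<alpha>" using params Z by (simp add: field_simps)
    have d_eq: "d\<^sub>\<alpha> = 1 / \<alpha> / 4 - l\<^sub>f / 2 - \<rho>\<^sub>2 / 2 - l\<^sub>f\<^sup>2 * \<rho>\<^sub>1 - 2 * L\<^sub>\<Phi>"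
      unfolding d_alpha a c_eta using params by (simp add: field_simps)
    have nn: "\<nu> / \<rho>\<^sub>2 > 0" "chi\<^sub>e * \<nu> > 0" "l\<^sub>f\<^sup>2 * \<rho>\<^sub>1 \<ge> 0" using diss_pos rho chi_e by auto
    have "4 * d\<^sub>\<alpha> = 1 / \<alpha> - Z + 8 * (\<nu> / \<rho>\<^sub>2) + 16 * (chi\<^sub>e * \<nu>)"
      unfolding d_eq Z_def by (simp add: right_diff_distrib)
    then have "d\<^sub>\<alpha> > 0" using Z_less nn by linarith
    have "C\<^sub>1\<^sup>2 / \<alpha> > 0" "2 * L\<^sub>\<Phi> * C\<^sub>1\<^sup>2 > 0" "C\<^sub>1\<^sup>2 / (2 * \<rho>\<^sub>1) > 0"
      using params const_pos rho C1(1) by auto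
    then have C_sh_ge: "c \<le> C\<^sub>s\<^sub>h" "C\<^sub>s\<^sub>h > 0"
      using c unfolding C_sh c_def by linarith+
    have "\<kappa>\<^sub>1 * (d\<^sub>\<alpha> * C\<^sub>1\<^sup>2 / 2 + C\<^sub>s\<^sub>h) < d\<^sub>\<alpha> / 4 - \<nu> / (2 * \<rho>\<^sub>2) - chi\<^sub>e * \<nu>"
      using kappa1 \<open>d\<^sub>\<alpha> > 0\<close> C_sh_ge(2) C1(1) by (simp add: pos_less_divide_eq add_pos_pos)
    moreover have "\<kappa>\<^sub>1 * c \<le> \<kappa>\<^sub>1 * (d\<^sub>\<alpha> * C\<^sub>1\<^sup>2 / 2 + C\<^sub>s\<^sub>h)"
      using kappa(1) C_sh_ge(1) \<open>d\<^sub>\<alpha> > 0\<close> by (intro mult_left_mono) (auto intro: add_increasing)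
    moreover have "p - d\<^sub>\<alpha> = 3 / 4 * (1 / \<alpha>) + l\<^sub>f\<^sup>2 * \<rho>\<^sub>1 + L\<^sub>\<Phi>"
      unfolding p_def d_eq using params by (simp add: field_simps)
    then have "p \<ge> d\<^sub>\<alpha>"
      using nn const_pos Z Z_less by linarith
    moreover have "\<theta> * \<nu> = \<nu> / (2 * \<rho>\<^sub>2) + chi\<^sub>e * \<nu>" by (simp add: \<theta>_def algebra_simps)
    ultimately show "p - \<theta> * \<nu> - c * \<kappa>\<^sub>1 > 0" "p \<ge> 0"
      using \<open>d\<^sub>\<alpha> > 0\<close> by (auto simp: mult.commute)
  qed

  define b where "b k = c * (\<kappa>\<^sub>2 * (real k - real k\<^sub>0) powr (- r))" for k
  have b: "summable b" unfolding b_def using r by (intro summable_mult summable_shifted_powr) simp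
  \<comment> \<open>A maximum of nonnegative numbers is at most their sum, which splits the
    tolerance into a delayed step term and a summable deterministic one.\<close>
  have \<Delta>_le: "\<Delta> k \<omega> \<le> \<kappa>\<^sub>1 * (norm (\<eta> (k - 1) \<omega>))\<^sup>2 + \<kappa>\<^sub>2 * (real k - real k\<^sub>0) powr (- r)"
    if \<omega>: "\<omega> \<in> \<Omega>" and k: "k \<ge> k\<^sub>0 + 1" for k \<omega>
  proof -
    have "0 \<le> \<kappa>\<^sub>1 * (norm (\<eta> (k - 1) \<omega>))\<^sup>2" "0 \<le> \<kappa>\<^sub>2 * (real k - real k\<^sub>0) powr (- r)"
      using kappa by auto
    then show ?thesis using Delta[of \<omega> k] \<omega> k unfolding \<Omega>_def by linarith
  qed
  have descent: "\<Phi> (x (Suc k) \<omega>) + p * (norm (\<eta> k \<omega>))\<^sup>2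
      \<le> \<Phi> (x k \<omega>) + ((norm (e k \<omega>))\<^sup>2 / (2 * \<rho>\<^sub>2) + c * \<kappa>\<^sub>1 * (norm (\<eta> (k - 1) \<omega>))\<^sup>2 + b k)"
    if \<omega>: "\<omega> \<in> \<Omega>" and k: "k \<ge> k\<^sub>0 + 1" for k \<omega>
  proof -
    let ?x = "x k \<omega>" and ?\<eta> = "\<eta> k \<omega>"
    have le: "norm ?\<eta> \<le> \<delta>" using \<eta>_le[OF \<omega>, of k] by (simp add: d_def)
    have "\<bar>\<Phi> (Retr ?x ?\<eta>) - \<Phi> (?x + ?\<eta>)\<bar> \<le> L\<^sub>\<Phi> * (norm ?\<eta>)\<^sup>2"
      using geometry_bounds[OF xM[OF \<omega>]] \<eta>T[OF \<omega>] le by (auto simp: T_def)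
    moreover have "x (Suc k) \<omega> = Retr ?x ?\<eta>" using step_e full_step \<omega> by (simp add: \<Omega>_def)
    ultimately have 1: "\<Phi> (x (Suc k) \<omega>) \<le> F (?x + ?\<eta>) + R (?x + ?\<eta>) + L\<^sub>\<Phi> * (norm ?\<eta>)\<^sup>2"
      by (simp add: Phi_eq)
    \<comment> \<open>The segment may leave \<open>M\<close>, so the Lipschitz gradient is used in
      the tube, which contains all shortened tangent steps.\<close>
    have 2: "F (?x + ?\<eta>) \<le> F ?x + gradient F ?x \<bullet> ?\<eta> + l\<^sub>f / 2 * (norm ?\<eta>)\<^sup>2"
    proof (rule smooth_descent[OF gF gF_lip])
      fix t :: real assume t: "t \<in> {0..1}"
      have "norm (t *\<^sub>R ?\<eta>) \<le> \<delta>" using t le mult_right_mono[of t 1 "norm ?\<eta>"] by auto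
      then show "?x + t *\<^sub>R ?\<eta> \<in> U"
        using T[OF xM[OF \<omega>]] \<eta>T[OF \<omega>] xM[OF \<omega>]
        by (intro tube) (auto simp: T_def subspace_scale)
    qed
    have 3: "gradient F ?x \<bullet> ?\<eta> = m k \<omega> \<bullet> ?\<eta> - e k \<omega> \<bullet> ?\<eta>"
      using rg_inner[OF xM[OF \<omega>] \<eta>T[OF \<omega>]] e_eq[of \<omega> k] \<omega> by (simp add: \<Omega>_def inner_diff_left)
    have 4: "- (e k \<omega> \<bullet> ?\<eta>) \<le> (norm (e k \<omega>))\<^sup>2 / (2 * \<rho>\<^sub>2) + \<rho>\<^sub>2 / 2 * (norm ?\<eta>)\<^sup>2"
      using rho(2) by (rule young_inner_le)
    have 5: "c * \<Delta> k \<omega> \<le> c * \<kappa>\<^sub>1 * (norm (\<eta> (k - 1) \<omega>))\<^sup>2 + b k"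
      using mult_left_mono[OF \<Delta>_le[OF \<omega> k] c] by (simp add: b_def algebra_simps)
    have 6: "p * (norm ?\<eta>)\<^sup>2 = (norm ?\<eta>)\<^sup>2 / \<alpha> - l\<^sub>f / 2 * (norm ?\<eta>)\<^sup>2 - \<rho>\<^sub>2 / 2 * (norm ?\<eta>)\<^sup>2
        - L\<^sub>\<Phi> * (norm ?\<eta>)\<^sup>2"
      by (simp add: p_def left_diff_distrib)
    have 7: "2 * l\<^sub>R * (C\<^sub>0 * \<Delta> k \<omega>) = c * \<Delta> k \<omega>" by (simp add: c_def)
    have 8: "\<Phi> ?x = F ?x + R ?x" by (simp add: Phi_eq)
    show ?thesis using 1 2 3 4 5 6 step[OF \<omega>, of k, unfolded 7] 8 by linarith
  qed

  \<comment> \<open>Measurability and integrability\<close>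
  have sub: "subalgebra P (\<F> k)" for k
    unfolding filtration by (rule subalgebra_history) (fact random_variables)+
  note [measurable] = random_variables(1-5)
  \<comment> \<open>Measurability of \<open>e k\<close> is rebuilt from \<open>u\<close>,
    \<open>mbar\<close>, \<open>chi\<close> and \<open>x\<close> through the recursion.\<close>
  have [measurable]: "e k \<in> borel_measurable P" for k
  proof -
    have [measurable]: "chi k \<in> borel_measurable P"
      using measurable_from_subalg[OF sub params_measurable(3)] .
    have [measurable]: "(\<lambda>\<omega>. closest_point (cball 0 M\<^sub>u) (u k \<omega>)) \<in> borel_measurable P"
      by (rule borel_measurable_continuous_on[OF continuous_on_closest_point random_variables(3)])
        (use M\<^sub>u in auto)
    have "(\<lambda>\<omega>. if k = 0 then riem_grad M F x\<^sub>0 else closest_point (cball 0 M\<^sub>u) (u k \<omega>)) \<in> borel_measurable P"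
      by measurable
    moreover have "(if k = 0 then riem_grad M F x\<^sub>0 else closest_point (cball 0 M\<^sub>u) (u k \<omega>)) = uhat k \<omega>"
      if "\<omega> \<in> space P" for \<omega> using init(2)[OF that] step_a[of k \<omega>] that
      by (cases "k = 0") simp_all
    ultimately have [measurable]: "uhat k \<in> borel_measurable P"
      by (rule measurable_cong[THEN iffD1, rotated])
    \<comment> \<open>The Riemannian gradient is continuous only on \<open>M\<close>, so
      \<open>x k\<close> is regarded as a map into \<open>M\<close>.\<close>
    have "x k \<in> measurable P (restrict_space borel M)"
      using xM random_variables(1) by (intro measurable_restrict_space2) (auto simp: \<Omega>_def)
    from measurable_compose[OF this borel_measurable_continuous_on_restrict[OF rg_cont]]
    have [measurable]: "(\<lambda>\<omega>. riem_grad M F (x k \<omega>)) \<in> borel_measurable P" .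
    have "(\<lambda>\<omega>. chi k \<omega> *\<^sub>R mbar k \<omega> + (1 - chi k \<omega>) *\<^sub>R uhat k \<omega> - riem_grad M F (x k \<omega>)) \<in> borel_measurable P"
      by measurable
    moreover have "chi k \<omega> *\<^sub>R mbar k \<omega> + (1 - chi k \<omega>) *\<^sub>R uhat k \<omega> - riem_grad M F (x k \<omega>) = e k \<omega>"
      if "\<omega> \<in> space P" for \<omega> using e_eq[OF that] step_b[OF that] by simp
    ultimately show ?thesis by (rule measurable_cong[THEN iffD1, rotated])
  qed
  have e_le: "norm (e k \<omega>) \<le> 2 * M\<^sub>u" if "\<omega> \<in> \<Omega>" for k \<omega>
    using norm_triangle_ineq4[of "m k \<omega>" "riem_grad M F (x k \<omega>)"] m_le[OF that, of k]
      rg_le[OF xM[OF that, of k]] e_eq[of \<omega> k] that by (simp add: \<Omega>_def)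
  have Err_nn: "Err k \<omega> \<ge> 0" if "\<omega> \<in> \<Omega>" for k \<omega>
    using dissipation that by (simp add: error_dissipation_def \<Omega>_def)
  obtain C\<^sub>\<Phi> where C\<^sub>\<Phi>: "\<And>y. y \<in> M \<Longrightarrow> \<bar>\<Phi> y\<bar> \<le> C\<^sub>\<Phi>"
    using compact_imp_bounded[OF compact_continuous_image[OF \<Phi>_cont M_compact]]
    unfolding bounded_iff by auto
  have \<Phi>_meas[measurable]: "(\<lambda>\<omega>. \<Phi> (x k \<omega>)) \<in> borel_measurable P" for k
    by (rule borel_measurable_continuous_on[OF \<Phi>_cont]) simp
  have int_\<Phi>: "integrable P (\<lambda>\<omega>. \<Phi> (x k \<omega>))" for k
    using C\<^sub>\<Phi> xM by (intro integrable_const_bound[where B = C\<^sub>\<Phi>]) (auto simp: \<Omega>_def)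
  have int_\<eta>: "integrable P (\<lambda>\<omega>. (norm (\<eta> k \<omega>))\<^sup>2)" for k
    using \<eta>_le by (intro integrable_const_bound[where B = "d\<^sup>2"]) (auto simp: \<Omega>_def intro!: power_mono)
  have int_e: "integrable P (\<lambda>\<omega>. (norm (e k \<omega>))\<^sup>2)" for k
    using power_mono[OF e_le, of _ k 2]
    by (intro integrable_const_bound[where B = "(2 * M\<^sub>u)\<^sup>2"]) (auto simp: \<Omega>_def)

  \<comment> \<open>Summable expectations\<close>
  define \<phi> H Q S where "\<phi> k = expectation (\<lambda>\<omega>. \<Phi> (x k \<omega>))"
    and "H k = expectation (\<lambda>\<omega>. (norm (\<eta> k \<omega>))\<^sup>2)"
    and "Q k = expectation (\<lambda>\<omega>. (norm (e k \<omega>))\<^sup>2)" and "S k = expectation (Err k)" for k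
  have e_le': "norm (e k \<omega>) \<le> 2 * M\<^sub>u" and \<eta>_le': "norm (\<eta> k \<omega>) \<le> d" if "\<omega> \<in> space P" for k \<omega>
    using e_le \<eta>_le that by (auto simp: \<Omega>_def)
  have int_Err: "integrable P (Err k)"
    and diss: "Q k + \<mu> * S k + c\<^sub>e * S (Suc k) \<le> c\<^sub>e * S k + \<nu> * H k" for k
    unfolding Q_def S_def H_def
    by (rule error_dissipation_expectation[OF dissipation sub _ _ e_le' \<eta>_le']; simp)+
  have nn: "H k \<ge> 0" "Q k \<ge> 0" "S k \<ge> 0" for k
    unfolding H_def Q_def S_def using Err_nn by (auto intro!: integral_nonneg_AE simp: \<Omega>_def)
  have \<phi>_step: "\<phi> (Suc k) + p * H k \<le> \<phi> k + (Q k / (2 * \<rho>\<^sub>2) + c * \<kappa>\<^sub>1 * H (k - 1) + b k)"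
    if k: "k \<ge> k\<^sub>0 + 1" for k
  proof -
    have "expectation (\<lambda>\<omega>. \<Phi> (x (Suc k) \<omega>) + p * (norm (\<eta> k \<omega>))\<^sup>2)
        \<le> expectation (\<lambda>\<omega>. \<Phi> (x k \<omega>) + ((norm (e k \<omega>))\<^sup>2 / (2 * \<rho>\<^sub>2)
            + c * \<kappa>\<^sub>1 * (norm (\<eta> (k - 1) \<omega>))\<^sup>2 + b k))"
      using descent[OF _ k] int_\<Phi> int_\<eta> int_e
      by (intro integral_mono) (auto simp: \<Omega>_def)
    then show ?thesis
      using int_\<Phi> int_\<eta> int_e by (simp add: \<phi>_def H_def Q_def prob_space)
  qed
  \<comment> \<open>The last term stores the delayed part of \<open>\<Delta> k\<close>: in
    \<open>W (Suc k)\<close> it becomes \<open>c * \<kappa>\<^sub>1 * H k\<close>, which the margin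
    pays for. The descent is invoked only from \<open>k\<^sub>0 + 1\<close> on, where
    \<open>k - 1\<close> is not truncated.\<close>
  define W where "W k = \<phi> k + \<theta> * c\<^sub>e * S k + c * \<kappa>\<^sub>1 * H (k - 1)" for k
  define g where "g k = chi\<^sub>e * Q k + \<theta> * \<mu> * S k + (p - \<theta> * \<nu> - c * \<kappa>\<^sub>1) * H k" for k
  have chi_e_pos: "chi\<^sub>e > 0" using chi_e rho by simp
  have "summable g"
  proof (rule perturbed_descent_convergence(1)[where V = W and b = b and K = "k\<^sub>0 + 1" and C = "- C\<^sub>\<Phi>"])
    fix k assume k: "k \<ge> k\<^sub>0 + 1"
    have "\<theta> * (Q k + \<mu> * S k + c\<^sub>e * S (Suc k)) \<le> \<theta> * (c\<^sub>e * S k + \<nu> * H k)"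
      using diss \<theta> by (intro mult_left_mono) auto
    moreover have "\<theta> * Q k = Q k / (2 * \<rho>\<^sub>2) + chi\<^sub>e * Q k" by (simp add: \<theta>_def algebra_simps)
    ultimately show "W (Suc k) + g k \<le> W k + b k"
      using \<phi>_step[OF k] unfolding W_def g_def by (simp add: algebra_simps)
  next
    fix k
    have "\<phi> k \<ge> expectation (\<lambda>_. - C\<^sub>\<Phi>)"
      unfolding \<phi>_def using C\<^sub>\<Phi> xM int_\<Phi>
      by (intro integral_mono) (auto simp: \<Omega>_def abs_le_iff minus_le_iff)
    moreover have "0 \<le> \<theta> * c\<^sub>e * S k" "0 \<le> c * \<kappa>\<^sub>1 * H (k - 1)"
      using \<theta> diss_pos nn c kappa by auto
    ultimately show "W k \<ge> - C\<^sub>\<Phi>" by (simp add: W_def prob_space)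
    show "g k \<ge> 0" using chi_e_pos \<theta> diss_pos nn margin by (simp add: g_def)
  qed (rule b)
  have summable_part: "summable h" if "\<And>k. 0 \<le> h k" "z > 0" "\<And>k. z * h k \<le> g k" for h :: "nat \<Rightarrow> real" and z
  proof (rule summable_comparison_test')
    show "summable (\<lambda>k. g k / z)" using \<open>summable g\<close> by (rule summable_divide)
    show "norm (h k) \<le> g k / z" for k using that by (simp add: field_simps)
  qed
  have parts: "0 \<le> chi\<^sub>e * Q k" "0 \<le> \<theta> * \<mu> * S k" "0 \<le> (p - \<theta> * \<nu> - c * \<kappa>\<^sub>1) * H k" for k
    using chi_e_pos \<theta> diss_pos nn margin by auto
  have "summable Q" by (rule summable_part[OF nn(2) chi_e_pos]) (use parts in \<open>simp add: g_def\<close>)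
  moreover have "summable S"
    by (rule summable_part[OF nn(3), of "\<theta> * \<mu>"]) (use parts \<theta> diss_pos in \<open>auto simp: g_def\<close>)
  moreover have "summable H" by (rule summable_part[OF nn(1) margin(1)]) (use parts in \<open>simp add: g_def\<close>)
  ultimately have "AE \<omega> in P. summable (\<lambda>k. (norm (\<eta> k \<omega>))\<^sup>2)" "AE \<omega> in P. summable (\<lambda>k. (norm (e k \<omega>))\<^sup>2)"
      "AE \<omega> in P. summable (\<lambda>k. Err k \<omega>)"
    unfolding H_def Q_def S_def using Err_nn
    by (auto intro!: AE_summable int_\<eta> int_e int_Err simp: \<Omega>_def)
  then have good: "AE \<omega> in P. \<omega> \<in> \<Omega> \<and> summable (\<lambda>k. (norm (\<eta> k \<omega>))\<^sup>2) \<and>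
      summable (\<lambda>k. (norm (e k \<omega>))\<^sup>2) \<and> summable (\<lambda>k. Err k \<omega>)"
    using AE_space by eventually_elim (simp add: \<Omega>_def)

  \<comment> \<open>Minimality of the exact tangent steps\<close>
  have \<eta>hat: "\<eta>hat k \<omega> \<in> T (x k \<omega>)"
    "\<And>v. v \<in> T (x k \<omega>) \<Longrightarrow> tangent_model \<alpha> R (x k \<omega>) (m k \<omega>) (\<eta>hat k \<omega>) \<le> tangent_model \<alpha> R (x k \<omega>) (m k \<omega>) v"
    if \<omega>: "\<omega> \<in> \<Omega>" for k \<omega>
  proof -
    let ?h = "\<lambda>v. m k \<omega> \<bullet> v + R (x k \<omega> + v)"
    have "(norm (m k \<omega>) + l\<^sub>R)-lipschitz_on UNIV ?h"
    proof (rule lipschitz_on_add)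
      show "(norm (m k \<omega>))-lipschitz_on UNIV (\<lambda>v. m k \<omega> \<bullet> v)"
        by (rule lipschitz_onI) (auto simp: dist_norm Cauchy_Schwarz_ineq2 simp flip: inner_diff_right)
      show "l\<^sub>R-lipschitz_on UNIV (\<lambda>v. R (x k \<omega> + v))"
        using lipschitz_onD[OF R_Lip, of "x k \<omega> + _" "x k \<omega> + _"] l\<^sub>R
        by (auto intro!: lipschitz_onI simp: dist_norm)
    qed
    \<comment> \<open>\<open>arg_min_on\<close> is a choice operator, so a minimizer must be
      exhibited; the model is a Lipschitz function plus a quadratic centred at 0.\<close>
    from proximal_minimizer_exists[OF this closed_subspace[OF T[OF xM[OF \<omega>]]], of k "1 / (2 * \<alpha>)" 0]
    obtain p' where p': "p' \<in> T (x k \<omega>)"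
      "\<And>v. v \<in> T (x k \<omega>) \<Longrightarrow> tangent_model \<alpha> R (x k \<omega>) (m k \<omega>) p' \<le> tangent_model \<alpha> R (x k \<omega>) (m k \<omega>) v"
      using subspace_0[OF T[OF xM[OF \<omega>]], of k] params(1)
      by (auto simp: tangent_model_def algebra_simps)
    have "\<eta>hat k \<omega> = arg_min_on (tangent_model \<alpha> R (x k \<omega>) (m k \<omega>)) (T (x k \<omega>))"
      using eta_hat \<omega> by (simp add: \<Omega>_def T_def)
    then show "\<eta>hat k \<omega> \<in> T (x k \<omega>)"
      "\<And>v. v \<in> T (x k \<omega>) \<Longrightarrow> tangent_model \<alpha> R (x k \<omega>) (m k \<omega>) (\<eta>hat k \<omega>) \<le> tangent_model \<alpha> R (x k \<omega>) (m k \<omega>) v"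
      using arg_min_on_minimizer[of p' "T (x k \<omega>)"  "tangent_model \<alpha> R (x k \<omega>) (m k \<omega>)"] p' by auto
  qed

  \<comment> \<open>Conclusions along almost every trajectory\<close>
  define \<Phi>lim where "\<Phi>lim \<omega> = lim (\<lambda>k. \<Phi> (x k \<omega>))" for \<omega>
  have pathwise: "(\<lambda>k. shifted_objective M \<Phi> (x k \<omega>) (\<eta>hat k \<omega>)) \<longlonglongrightarrow> ereal (\<Phi>lim \<omega>) \<and>
      ((\<lambda>k. \<eta>hat k \<omega>) \<longlonglongrightarrow> 0 \<and> (\<lambda>k. \<eta> k \<omega>) \<longlonglongrightarrow> 0 \<and> (\<lambda>k. e k \<omega>) \<longlonglongrightarrow> 0 \<and> (\<lambda>k. Err k \<omega>) \<longlonglongrightarrow> 0) \<and>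
      (\<forall>z. (\<exists>s. strict_mono s \<and> (\<lambda>i. x (s i) \<omega>) \<longlonglongrightarrow> z) \<longrightarrow> critical_point M F R z)"
    if \<omega>: "\<omega> \<in> \<Omega>" and sum_\<eta>: "summable (\<lambda>k. (norm (\<eta> k \<omega>))\<^sup>2)"
      and sum_e: "summable (\<lambda>k. (norm (e k \<omega>))\<^sup>2)" and sum_Err: "summable (\<lambda>k. Err k \<omega>)" for \<omega>
  proof -
    have sq0: "X \<longlonglongrightarrow> 0" if "summable (\<lambda>k. (norm (X k))\<^sup>2)" for X :: "nat \<Rightarrow> 'a"
    proof -
      have "(\<lambda>k. sqrt ((norm (X k))\<^sup>2)) \<longlonglongrightarrow> sqrt 0"
        using summable_LIMSEQ_zero[OF that] by (rule tendsto_real_sqrt)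
      then show ?thesis by (simp add: tendsto_norm_zero_iff)
    qed
    have \<eta>0: "(\<lambda>k. \<eta> k \<omega>) \<longlonglongrightarrow> 0" and e0: "(\<lambda>k. e k \<omega>) \<longlonglongrightarrow> 0" using sq0 sum_\<eta> sum_e by auto
    have Err0: "(\<lambda>k. Err k \<omega>) \<longlonglongrightarrow> 0" using sum_Err by (rule summable_LIMSEQ_zero)
    \<comment> \<open>At \<open>k = 0\<close> truncated subtraction merely repeats the first
      term.\<close>
    have sum_\<eta>': "summable (\<lambda>k. (norm (\<eta> (k - 1) \<omega>))\<^sup>2)"
      using sum_\<eta> by (subst summable_Suc_iff[symmetric]) simp
    have \<Delta>0: "(\<lambda>k. \<Delta> k \<omega>) \<longlonglongrightarrow> 0"
    proof (rule Lim_null_comparison)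
      show "eventually (\<lambda>k. norm (\<Delta> k \<omega>) \<le> \<kappa>\<^sub>1 * (norm (\<eta> (k - 1) \<omega>))\<^sup>2
          + \<kappa>\<^sub>2 * (real k - real k\<^sub>0) powr (- r)) sequentially"
        using eventually_ge_at_top[of "k\<^sub>0 + 1"] by eventually_elim (use \<Delta>_le \<Delta>_range \<omega> in auto)
      have "summable (\<lambda>k. \<kappa>\<^sub>1 * (norm (\<eta> (k - 1) \<omega>))\<^sup>2 + \<kappa>\<^sub>2 * (real k - real k\<^sub>0) powr (- r))"
        using sum_\<eta>' r by (intro summable_add summable_mult summable_shifted_powr) auto
      then show "(\<lambda>k. \<kappa>\<^sub>1 * (norm (\<eta> (k - 1) \<omega>))\<^sup>2 + \<kappa>\<^sub>2 * (real k - real k\<^sub>0) powr (- r)) \<longlonglongrightarrow> 0"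
        by (rule summable_LIMSEQ_zero)
    qed
    have \<eta>hat0: "(\<lambda>k. \<eta>hat k \<omega>) \<longlonglongrightarrow> 0"
    proof (rule Lim_null_comparison[OF always_eventually])
      have "norm (\<eta>hat k \<omega>) \<le> norm (\<eta> k \<omega>) + C\<^sub>1 * sqrt (\<Delta> k \<omega>)" for k
        using C1(2)[of \<omega> k] \<omega> norm_triangle_ineq4[of "\<eta> k \<omega>" "\<eta> k \<omega> - \<eta>hat k \<omega>"] by (simp add: \<Omega>_def)
      then show "\<forall>k. norm (\<eta>hat k \<omega>) \<le> norm (\<eta> k \<omega>) + C\<^sub>1 * sqrt (\<Delta> k \<omega>)" ..
      have "(\<lambda>k. norm (\<eta> k \<omega>) + C\<^sub>1 * sqrt (\<Delta> k \<omega>)) \<longlonglongrightarrow> norm (0::'a) + C\<^sub>1 * sqrt 0"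
        by (intro tendsto_intros \<eta>0 \<Delta>0)
      then show "(\<lambda>k. norm (\<eta> k \<omega>) + C\<^sub>1 * sqrt (\<Delta> k \<omega>)) \<longlonglongrightarrow> 0" by simp
    qed
    have "convergent (\<lambda>k. \<Phi> (x k \<omega>))"
    proof (rule perturbed_descent_convergence(2))
      show "\<Phi> (x (Suc k) \<omega>) + p * (norm (\<eta> k \<omega>))\<^sup>2
          \<le> \<Phi> (x k \<omega>) + ((norm (e k \<omega>))\<^sup>2 / (2 * \<rho>\<^sub>2) + c * \<kappa>\<^sub>1 * (norm (\<eta> (k - 1) \<omega>))\<^sup>2 + b k)"
        if "k \<ge> k\<^sub>0 + 1" for k using descent[OF \<omega> that] .
      show "summable (\<lambda>k. (norm (e k \<omega>))\<^sup>2 / (2 * \<rho>\<^sub>2) + c * \<kappa>\<^sub>1 * (norm (\<eta> (k - 1) \<omega>))\<^sup>2 + b k)"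
        by (intro summable_add summable_mult summable_divide sum_e sum_\<eta>' b)
      show "p * (norm (\<eta> k \<omega>))\<^sup>2 \<ge> 0" for k using margin(2) by simp
      show "\<Phi> (x k \<omega>) \<ge> - C\<^sub>\<Phi>" for k using C\<^sub>\<Phi>[OF xM[OF \<omega>, of k]] by linarith
    qed
    then have \<Phi>_lim: "(\<lambda>k. \<Phi> (x k \<omega>)) \<longlonglongrightarrow> \<Phi>lim \<omega>"
      unfolding \<Phi>lim_def by (simp add: convergent_LIMSEQ_iff)
    \<comment> \<open>The iterates themselves need not converge, so pointwise continuity is not
      enough; \<Phi> is uniformly continuous on a compact neighbourhood of \<open>M\<close>
      containing all points involved.\<close>
    have "(\<lambda>k. \<Phi> (x k \<omega> + \<eta>hat k \<omega>) - \<Phi> (x k \<omega>)) \<longlonglongrightarrow> 0"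
    proof -
      obtain K where K: "\<And>k. norm (\<eta>hat k \<omega>) \<le> K"
        using convergent_imp_bounded[OF \<eta>hat0] unfolding bounded_iff by auto
      define N' where "N' = {y + v | y v. y \<in> M \<and> v \<in> cball (0::'a) K}"
      have "compact N'" unfolding N'_def by (intro compact_sums M_compact compact_cball)
      then have "uniformly_continuous_on N' \<Phi>" by (intro compact_uniformly_continuous \<Phi>_cont)
      moreover have "x k \<omega> + \<eta>hat k \<omega> \<in> N'" "x k \<omega> \<in> N'" for k
      proof -
        have "x k \<omega> + v \<in> N'" if "norm v \<le> K" for v
          unfolding N'_def using xM[OF \<omega>, of k] that by auto
        from this[of "\<eta>hat k \<omega>"] this[of 0] show "x k \<omega> + \<eta>hat k \<omega> \<in> N'" "x k \<omega> \<in> N'"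
          using K[of k] order_trans[OF norm_ge_zero K[of k]] by auto
      qed
      moreover have "(\<lambda>k. dist (x k \<omega> + \<eta>hat k \<omega>) (x k \<omega>)) \<longlonglongrightarrow> 0"
        using tendsto_norm_zero[OF \<eta>hat0] by (simp add: dist_norm)
      ultimately have "(\<lambda>k. dist (\<Phi> (x k \<omega> + \<eta>hat k \<omega>)) (\<Phi> (x k \<omega>))) \<longlonglongrightarrow> 0"
        unfolding uniformly_continuous_on_sequentially
        by (elim allE[of _ "\<lambda>k. x k \<omega> + \<eta>hat k \<omega>"] allE[of _ "\<lambda>k. x k \<omega>"]) simp
      then show ?thesis by (simp add: dist_real_def tendsto_rabs_zero_iff)
    qed
    from tendsto_add[OF this \<Phi>_lim] have "(\<lambda>k. \<Phi> (x k \<omega> + \<eta>hat k \<omega>)) \<longlonglongrightarrow> \<Phi>lim \<omega>" by simp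
    then have "(\<lambda>k. shifted_objective M \<Phi> (x k \<omega>) (\<eta>hat k \<omega>)) \<longlonglongrightarrow> ereal (\<Phi>lim \<omega>)"
      using xM[OF \<omega>] \<eta>hat(1)[OF \<omega>]
      by (simp add: shifted_objective_def tangent_bundle_def T_def)
    moreover have "critical_point M F R z" if s: "strict_mono s" and xz: "(\<lambda>i. x (s i) \<omega>) \<longlonglongrightarrow> z" for s z
    proof -
      have zM: "z \<in> M"
        using closed_sequentially[OF compact_imp_closed[OF M_compact] _ xz] xM[OF \<omega>] by blast
      note seq = LIMSEQ_subseq_LIMSEQ[OF _ s, unfolded o_def]
      have model: "R z \<le> gradient F z \<bullet> v + (norm v)\<^sup>2 / (2 * \<alpha>) + R (z + v)" if v: "v \<in> T z" for v
      proof -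
        define y where "y i = x (s i) \<omega>" for i
        have yM: "y i \<in> M" for i using xM[OF \<omega>] by (simp add: y_def)
        have yz: "y \<longlonglongrightarrow> z" using xz by (simp add: y_def[abs_def])
        \<comment> \<open>The minimality of the exact step at \<open>y i\<close> admits only vectors
          tangent at \<open>y i\<close>, so \<open>v\<close> is projected there.\<close>
        define v' where "v' i = closest_point (T (y i)) v" for i
        have v': "v' \<longlonglongrightarrow> v"
          unfolding v'_def[abs_def] T_def using closest_tangent_tendsto[OF yM yz zM] v by (simp add: T_def)
        have v'T: "v' i \<in> T (y i)" for i
          unfolding v'_def by (intro closest_point_in_subspace T yM)
        \<comment> \<open>On the left the quadratic is dropped and \<open>m\<close> enters only
          through its bound. On the right \<open>v' i\<close> is tangent, so the Riemannian gradient
          becomes the Euclidean one, and all terms have limits.\<close>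
        have "R (y i + \<eta>hat (s i) \<omega>) - M\<^sub>u * norm (\<eta>hat (s i) \<omega>)
            \<le> (gradient F (y i) + e (s i) \<omega>) \<bullet> v' i + (norm (v' i))\<^sup>2 / (2 * \<alpha>) + R (y i + v' i)" for i
        proof -
          have "m (s i) \<omega> \<bullet> v' i = (gradient F (y i) + e (s i) \<omega>) \<bullet> v' i"
            using e_eq[of \<omega> "s i"] \<omega> rg_inner[OF yM v'T, of i]
            by (simp add: \<Omega>_def inner_simps y_def)
          moreover have "- (M\<^sub>u * norm (\<eta>hat (s i) \<omega>)) \<le> m (s i) \<omega> \<bullet> \<eta>hat (s i) \<omega>"
            using Cauchy_Schwarz_ineq2[of "m (s i) \<omega>" "\<eta>hat (s i) \<omega>"]
              mult_right_mono[OF m_le[OF \<omega>, of "s i"], of "norm (\<eta>hat (s i) \<omega>)"]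
            by (simp add: abs_le_iff)
          moreover have "0 \<le> (norm (\<eta>hat (s i) \<omega>))\<^sup>2 / (2 * \<alpha>)" using params(1) by simp
          ultimately show ?thesis
            using \<eta>hat(2)[OF \<omega>, of "v' i" "s i"] v'T[of i]
            unfolding tangent_model_def y_def by linarith
        qed
        moreover have Rc: "isCont R a" for a
          using R_cont[of UNIV] continuous_on_eq_continuous_at[OF open_UNIV] by blast
        have "(\<lambda>i. R (y i + \<eta>hat (s i) \<omega>) - M\<^sub>u * norm (\<eta>hat (s i) \<omega>)) \<longlonglongrightarrow> R (z + 0) - M\<^sub>u * norm (0::'a)"
          by (intro tendsto_intros isCont_tendsto_compose[OF Rc] yz seq[OF \<eta>hat0])
        moreover have "isCont (gradient F) z"
          using gF_cont[of UNIV] continuous_on_eq_continuous_at[OF open_UNIV] by blast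
        from isCont_tendsto_compose[OF this yz]
        have "(\<lambda>i. (gradient F (y i) + e (s i) \<omega>) \<bullet> v' i + (norm (v' i))\<^sup>2 / (2 * \<alpha>) + R (y i + v' i))
            \<longlonglongrightarrow> (gradient F z + 0) \<bullet> v + (norm v)\<^sup>2 / (2 * \<alpha>) + R (z + v)"
          using params(1) by (intro tendsto_intros isCont_tendsto_compose[OF Rc] yz v' seq[OF e0]) auto
        ultimately show ?thesis
          using LIMSEQ_le[of _ "R (z + 0) - M\<^sub>u * norm (0::'a)" _
              "(gradient F z + 0) \<bullet> v + (norm v)\<^sup>2 / (2 * \<alpha>) + R (z + v)"] by fastforce
      qed
      \<comment> \<open>By \<open>model\<close>, \<open>z\<close> minimizes a function with a
        quadratic penalty centred at \<open>z\<close> itself; the variational inequality removes the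
        penalty.\<close>
      have "R z \<le> R (z + v) + gradient F z \<bullet> v" if v: "v \<in> T z" for v
      proof -
        have "R (z + v) + gradient F z \<bullet> (z + v)
            \<ge> R z + gradient F z \<bullet> z - 2 * (1 / (2 * \<alpha>)) * ((z - z) \<bullet> (z + v - z))"
        proof (rule proximal_minimizer_variational[where S = "(+) z ` T z" and z = z
              and h = "\<lambda>y. R y + gradient F z \<bullet> y"])
          show "convex_on ((+) z ` T z) (\<lambda>y. R y + gradient F z \<bullet> y)"
          proof (rule convex_on_subset[OF convex_on_add[OF R_convex]])
            show "convex_on UNIV (\<lambda>y. gradient F z \<bullet> y)"
              by (auto simp: convex_on_def inner_simps)
            show "convex ((+) z ` T z)"
              by (intro convex_translation subspace_imp_convex T zM)
          qed simp
          fix y assume "y \<in> (+) z ` T z"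
          then obtain u where "y = z + u" "u \<in> T z" by auto
          then show "R z + gradient F z \<bullet> z + 1 / (2 * \<alpha>) * (norm (z - z))\<^sup>2
              \<le> R y + gradient F z \<bullet> y + 1 / (2 * \<alpha>) * (norm (y - z))\<^sup>2"
            using model[of u] by (simp add: inner_simps)
        qed (use v subspace_0[OF T[OF zM]] in auto)
        then show ?thesis by (simp add: inner_simps)
      qed
      from first_order_condition_on_subspace[OF R_convex T[OF zM] this]
      obtain s' where s': "s' \<in> subdifferential R z" "\<And>v. v \<in> T z \<Longrightarrow> (gradient F z + s') \<bullet> v = 0"
        by blast
      have "- (gradient F z + s') \<in> normal_space M z"
        using s'(2) unfolding normal_space_def orthogonal_comp_def orthogonal_def T_def
        by (auto simp: inner_commute simp del: minus_add_distrib)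
      moreover have "0 = gradient F z + s' + - (gradient F z + s')" by simp
      ultimately show ?thesis unfolding critical_point_def using zM s'(1) by blast
    qed
    ultimately show ?thesis using \<eta>hat0 \<eta>0 e0 Err0 by blast
  qed
  have "AE \<omega> in P. (\<lambda>k. shifted_objective M \<Phi> (x k \<omega>) (\<eta>hat k \<omega>)) \<longlonglongrightarrow> ereal (\<Phi>lim \<omega>)"
    using good by eventually_elim (use pathwise in blast)
  \<comment> \<open>\<open>lim\<close> assigns a value to every trajectory, convergent or not, so
    measurability holds without removing a null set.\<close>
  moreover have "\<Phi>lim \<in> borel_measurable P" unfolding \<Phi>lim_def by measurable
  moreover have "AE \<omega> in P. (\<lambda>k. \<eta>hat k \<omega>) \<longlonglongrightarrow> 0 \<and> (\<lambda>k. \<eta> k \<omega>) \<longlonglongrightarrow> 0 \<and>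
      (\<lambda>k. e k \<omega>) \<longlonglongrightarrow> 0 \<and> (\<lambda>k. Err k \<omega>) \<longlonglongrightarrow> 0"
    using good by eventually_elim (use pathwise in blast)
  moreover have "AE \<omega> in P. \<forall>z. (\<exists>s. strict_mono s \<and> (\<lambda>i. x (s i) \<omega>) \<longlonglongrightarrow> z) \<longrightarrow> critical_point M F R z"
    using good by eventually_elim (use pathwise in blast)
  ultimately show ?thesis by blast
qed

end
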